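(* Let $F\subseteq\mathbf{RO}(G,<_{\mathrm{red}},d)$. Then $F$ is confluent if and only if the rewriting relation $\to_F$ is $\delta$-confluent.
   Context: Let $\mathbb{K}$ be a commutative field with the discrete topology, $(G,<_{\mathrm{red}})$ a totally ordered set and $d:G\to\mathbb{R}_{>0}$ a map. $\mathbb{K}G$ is the vector space with basis $G$; $\pi_g:\mathbb{K}G\to\mathbb{K}$ maps $v$ to the coefficient of $g$ in $v$. Equip $\mathbb{K}G$ with the metric $\delta(u,v)=\max\{d(g)\mid\pi_g(u-v)\neq0\}$ (and $\delta(u,u)=0$), and let $(\widehat{\mathbb{K}G},\delta)$ be its completion, a topological vector space to which each $\pi_g$ extends continuously. $\overline{V}$ denotes topological closure. The support of $v\in\widehat{\mathbb{K}G}$ is $\mathrm{supp}(v)=\{g\in G\mid\pi_g(v)\neq0\}$. For $n\geq1$ let $G^{(n)}=\{g\in G\mid 1/n\leq d(g)<1/(n-1)\}$ (with $1/0=+\infty$). It is assumed that $d$ is an elimination map: it is non-decreasing ($g<_{\mathrm{red}}g'$ implies $d(g)\leq d(g')$) and each $G^{(n)}$ is well-ordered by $<_{\mathrm{red}}$. $\mathbf{RO}(G,<_{\mathrm{red}},d)$ is the set of reduction operators, i.e. continuous linear projectors $T$ of $\widehat{\mathbb{K}G}$ such that for every $g\in G$, $T(g)\neq g$ implies $g'<_{\mathrm{red}}g$ for every $g'\in\mathrm{supp}(T(g))$. Put $\mathrm{nf}(T)=\{g\in G\mid T(g)=g\}$. The map $T\mapsto\ker(T)$ is a bijection from $\mathbf{RO}(G,<_{\mathrm{red}},d)$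 onto closed subspaces of $\widehat{\mathbb{K}G}$, with inverse $\ker^{-1}$. Put $\wedge F=\ker^{-1}\big(\overline{\sum_{T\in F}\ker(T)}\big)$ and $\mathrm{nf}(F)=\bigcap_{T\in F}\mathrm{nf}(T)$; one has $\mathrm{nf}(\wedge F)\subseteq\mathrm{nf}(F)$. The set $F$ is confluent if $\mathrm{nf}(F)\setminus\mathrm{nf}(\wedge F)=\emptyset$. $\to_F$ is the binary relation on $\widehat{\mathbb{K}G}$ given by $v\to_F T(v)$ for all $v\in\widehat{\mathbb{K}G}$, $T\in F$. Say $v$ rewrites into $v'$ if $(v,v')$ is in the reflexive transitive closure of $\to_F$. Write $v\Rightarrow_F w$ if every neighbourhood of $w$ contains some $w'$ such that $v$ rewrites into $w'$. The relation $\to_F$ is $\delta$-confluent if whenever $a$ rewrites into $b$ and into $c$, there exists $e$ with $b\Rightarrow_F e$ and $c\Rightarrow_F e$. *)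

theory Defs
  imports "HOL-Analysis.Analysis" "HOL-Library.Function_Algebras"
begin

section \<open>The space of finite combinations and its completion\<close>

text \<open>
  The totally ordered set is a subset \<open>G\<close> of a type of class \<^class>\<open>linorder\<close>. Vectors are coefficient
  families \<open>'g \<Rightarrow> 'k\<close> that vanish outside \<open>G\<close>, with pointwise operations; the projection
  \<open>\<pi>\<^sub>g\<close> is \<open>\<lambda>v. v g\<close>.
\<close>

definition supp :: "('g \<Rightarrow> 'k::field) \<Rightarrow> 'g set" where
  "supp v = {g. v g \<noteq> 0}"

definition basis_vec :: "'g \<Rightarrow> 'g \<Rightarrow> 'k::field" where
  "basis_vec g = (\<lambda>h. if h = g then 1 else 0)"

definition scal :: "'k::field \<Rightarrow> ('g \<Rightarrow> 'k) \<Rightarrow> 'g \<Rightarrow> 'k" where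
  "scal c v = (\<lambda>g. c * v g)"

definition KG :: "'g set \<Rightarrow> ('g \<Rightarrow> 'k::field) set" where
  "KG G = {v. supp v \<subseteq> G \<and> finite (supp v)}"

text \<open>
  Model of the completion of \<open>KG G\<close>, as coefficient families. That it is a completion is proved at
  the end: the metric restricts to the maximum on \<open>KG G\<close> (\<open>delta_KG\<close>), \<open>KG G\<close> is dense (\<open>KG_dense\<close>),
  and the space is complete (\<open>hatKG_mcomplete\<close>). The operations are compatible with the metric
  (\<open>delta_add_right\<close>, \<open>delta_scal\<close>) and the projections are continuous (\<open>continuous_coeff\<close>), hence they
  are the continuous extensions of those of \<open>KG G\<close>.
\<close>

definition hatKG :: "'g set \<Rightarrow> ('g \<Rightarrow> real) \<Rightarrow> ('g \<Rightarrow> 'k::field) set" where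
  "hatKG G d = {v. supp v \<subseteq> G \<and> (\<forall>\<epsilon>>0. finite {g \<in> supp v. \<epsilon> \<le> d g})}"

text \<open>
  The supremum is attained even if \<open>supp (u - v)\<close> is infinite (\<open>delta_attained\<close>). The value 0 outside
  \<open>hatKG G d\<close> is required by \<^locale>\<open>Metric_space\<close>, which asks for non-negativity on the whole type.
\<close>

definition delta :: "'g set \<Rightarrow> ('g \<Rightarrow> real) \<Rightarrow> ('g \<Rightarrow> 'k::field) \<Rightarrow> ('g \<Rightarrow> 'k) \<Rightarrow> real" where
  "delta G d u v =
     (if u \<in> hatKG G d \<and> v \<in> hatKG G d \<and> u \<noteq> v then Sup (d ` supp (u - v)) else 0)"

abbreviation hat_topology :: "'g set \<Rightarrow> ('g \<Rightarrow> real) \<Rightarrow> ('g \<Rightarrow> 'k::field) topology" where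
  "hat_topology G d \<equiv> Metric_space.mtopology (hatKG G d) (delta G d)"


section \<open>Elimination maps\<close>

text \<open>The layer with index 1 has no upper bound (\<open>1/0\<close> is read as infinity).\<close>

definition layer :: "'g set \<Rightarrow> ('g \<Rightarrow> real) \<Rightarrow> nat \<Rightarrow> 'g set" where
  "layer G d n = {g \<in> G. 1 / real n \<le> d g \<and> (n = 1 \<or> d g < 1 / (real n - 1))}"

text \<open>As the order is total, well-foundedness of \<open><\<close> on a layer means that the layer is well-ordered.\<close>

definition elimination_map :: "'g::linorder set \<Rightarrow> ('g \<Rightarrow> real) \<Rightarrow> bool" where
  "elimination_map G d \<longleftrightarrow> mono_on G d \<and> (\<forall>n\<ge>1. wfp_on (layer G d n) (<))"


section \<open>Reduction operators\<close>

text \<open>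
  Operators are extensional functions on the completion (\<^const>\<open>undefined\<close> outside), so that equality in
  HOL is equality of operators and \<open>ker\<close> can be injective on \<open>RO G d\<close>.
\<close>

definition RO :: "'g::linorder set \<Rightarrow> ('g \<Rightarrow> real) \<Rightarrow> (('g \<Rightarrow> 'k::field) \<Rightarrow> ('g \<Rightarrow> 'k)) set" where
  "RO G d = {T \<in> hatKG G d \<rightarrow>\<^sub>E hatKG G d.
     (\<forall>u\<in>hatKG G d. \<forall>v\<in>hatKG G d. T (u + v) = T u + T v) \<and>
     (\<forall>c. \<forall>v\<in>hatKG G d. T (scal c v) = scal c (T v)) \<and>
     (\<forall>v\<in>hatKG G d. T (T v) = T v) \<and>
     continuous_map (hat_topology G d) (hat_topology G d) T \<and>
     (\<forall>g\<in>G. T (basis_vec g) \<noteq> basis_vec g \<longrightarrow> (\<forall>g'\<in>supp (T (basis_vec g)). g' < g))}"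

definition ker ::
  "'g set \<Rightarrow> ('g \<Rightarrow> real) \<Rightarrow> (('g \<Rightarrow> 'k::field) \<Rightarrow> ('g \<Rightarrow> 'k)) \<Rightarrow> ('g \<Rightarrow> 'k) set" where
  "ker G d T = {v \<in> hatKG G d. T v = 0}"

definition ker_inv ::
  "'g::linorder set \<Rightarrow> ('g \<Rightarrow> real) \<Rightarrow> ('g \<Rightarrow> 'k::field) set \<Rightarrow> (('g \<Rightarrow> 'k) \<Rightarrow> ('g \<Rightarrow> 'k))" where
  "ker_inv G d = inv_into (RO G d) (ker G d)"

definition sum_ker ::
  "'g set \<Rightarrow> ('g \<Rightarrow> real) \<Rightarrow> (('g \<Rightarrow> 'k::field) \<Rightarrow> ('g \<Rightarrow> 'k)) set \<Rightarrow> ('g \<Rightarrow> 'k) set" where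
  "sum_ker G d F = {\<Sum>T\<in>A. w T | A w. finite A \<and> A \<subseteq> F \<and> (\<forall>T\<in>A. w T \<in> ker G d T)}"

definition wedge ::
  "'g::linorder set \<Rightarrow> ('g \<Rightarrow> real) \<Rightarrow> (('g \<Rightarrow> 'k::field) \<Rightarrow> ('g \<Rightarrow> 'k)) set \<Rightarrow> (('g \<Rightarrow> 'k) \<Rightarrow> ('g \<Rightarrow> 'k))" where
  "wedge G d F = ker_inv G d (hat_topology G d closure_of sum_ker G d F)"

definition nf :: "'g set \<Rightarrow> (('g \<Rightarrow> 'k::field) \<Rightarrow> ('g \<Rightarrow> 'k)) \<Rightarrow> 'g set" where
  "nf G T = {g \<in> G. T (basis_vec g) = basis_vec g}"

text \<open>The intersection with \<open>G\<close> matters only for \<open>F = {}\<close>.\<close>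

definition nf_set :: "'g set \<Rightarrow> (('g \<Rightarrow> 'k::field) \<Rightarrow> ('g \<Rightarrow> 'k)) set \<Rightarrow> 'g set" where
  "nf_set G F = G \<inter> (\<Inter>T\<in>F. nf G T)"

definition confluent ::
  "'g::linorder set \<Rightarrow> ('g \<Rightarrow> real) \<Rightarrow> (('g \<Rightarrow> 'k::field) \<Rightarrow> ('g \<Rightarrow> 'k)) set \<Rightarrow> bool" where
  "confluent G d F \<longleftrightarrow> nf_set G F - nf G (wedge G d F) = {}"


section \<open>The rewriting relation\<close>

definition rew_step ::
  "'g set \<Rightarrow> ('g \<Rightarrow> real) \<Rightarrow> (('g \<Rightarrow> 'k::field) \<Rightarrow> ('g \<Rightarrow> 'k)) set \<Rightarrow> ('g \<Rightarrow> 'k) \<Rightarrow> ('g \<Rightarrow> 'k) \<Rightarrow> bool" where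
  "rew_step G d F v w \<longleftrightarrow> v \<in> hatKG G d \<and> (\<exists>T\<in>F. w = T v)"

abbreviation rewrites_into ::
  "'g set \<Rightarrow> ('g \<Rightarrow> real) \<Rightarrow> (('g \<Rightarrow> 'k::field) \<Rightarrow> ('g \<Rightarrow> 'k)) set \<Rightarrow> ('g \<Rightarrow> 'k) \<Rightarrow> ('g \<Rightarrow> 'k) \<Rightarrow> bool" where
  "rewrites_into G d F \<equiv> (rew_step G d F)\<^sup>*\<^sup>*"

definition top_rewrites ::
  "'g set \<Rightarrow> ('g \<Rightarrow> real) \<Rightarrow> (('g \<Rightarrow> 'k::field) \<Rightarrow> ('g \<Rightarrow> 'k)) set \<Rightarrow> ('g \<Rightarrow> 'k) \<Rightarrow> ('g \<Rightarrow> 'k) \<Rightarrow> bool" where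
  "top_rewrites G d F v w \<longleftrightarrow>
     (\<forall>U. openin (hat_topology G d) U \<and> w \<in> U \<longrightarrow> (\<exists>w'\<in>U. rewrites_into G d F v w'))"

definition delta_confluent ::
  "'g set \<Rightarrow> ('g \<Rightarrow> real) \<Rightarrow> (('g \<Rightarrow> 'k::field) \<Rightarrow> ('g \<Rightarrow> 'k)) set \<Rightarrow> bool" where
  "delta_confluent G d F \<longleftrightarrow>
     (\<forall>a\<in>hatKG G d. \<forall>b c. rewrites_into G d F a b \<and> rewrites_into G d F a c \<longrightarrow>
        (\<exists>e\<in>hatKG G d. top_rewrites G d F b e \<and> top_rewrites G d F c e))"


section \<open>The model is a completion\<close>

lemma supp_minus: "supp (u - v) = {g. u g \<noteq> v g}"
  by (simp add: supp_def)

lemma KG_subset_hatKG: "KG G \<subseteq> hatKG G d"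
  by (auto simp: KG_def hatKG_def)

lemma hatKG_mono:
  assumes "v \<in> hatKG G d" "supp u \<subseteq> supp v"
  shows "u \<in> hatKG G d"
proof -
  have "finite {g \<in> supp u. e \<le> d g}" if "0 < e" for e
    by (rule finite_subset[of _ "{g \<in> supp v. e \<le> d g}"]) (use assms that in \<open>auto simp: hatKG_def\<close>)
  then show ?thesis using assms by (auto simp: hatKG_def)
qed

lemma hatKG_scal: "v \<in> hatKG G d \<Longrightarrow> scal c v \<in> hatKG G d"
  by (erule hatKG_mono) (auto simp: supp_def scal_def)

lemma hatKG_add:
  assumes "u \<in> hatKG G d" "v \<in> hatKG G d" shows "u + v \<in> hatKG G d"
proof -
  have sub: "supp (u + v) \<subseteq> supp u \<union> supp v" by (auto simp: supp_def)
  have "finite {g \<in> supp (u + v). e \<le> d g}" if "0 < e" for e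
  proof (rule finite_subset)
    show "{g \<in> supp (u + v). e \<le> d g} \<subseteq> {g \<in> supp u. e \<le> d g} \<union> {g \<in> supp v. e \<le> d g}"
      using sub by blast
    show "finite ({g \<in> supp u. e \<le> d g} \<union> {g \<in> supp v. e \<le> d g})"
      using assms that by (simp add: hatKG_def)
  qed
  moreover have "supp (u + v) \<subseteq> G" using assms sub by (auto simp: hatKG_def)
  ultimately show ?thesis by (simp add: hatKG_def)
qed

lemma hatKG_diff:
  assumes "u \<in> hatKG G d" "v \<in> hatKG G d" shows "u - v \<in> hatKG G d"
proof -
  have "u - v = u + scal (-1) v" by (simp add: scal_def fun_eq_iff)
  then show ?thesis by (simp only: hatKG_add[OF assms(1) hatKG_scal[OF assms(2)]])
qed

lemma delta_add_right:
  assumes "u \<in> hatKG G d" "v \<in> hatKG G d" "w \<in> hatKG G d"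
  shows "delta G d (u + w) (v + w) = delta G d u v"
  using assms by (simp add: delta_def hatKG_add)

lemma delta_scal:
  assumes "u \<in> hatKG G d" "v \<in> hatKG G d" "c \<noteq> 0"
  shows "delta G d (scal c u) (scal c v) = delta G d u v"
proof -
  have "scal c u = scal c v \<longleftrightarrow> u = v" "supp (scal c u - scal c v) = supp (u - v)"
    using assms(3) by (auto simp: supp_def scal_def fun_eq_iff)
  then show ?thesis using assms by (simp add: delta_def hatKG_scal)
qed

lemma delta_attained:
  assumes "\<forall>g\<in>G. 0 < d g" "u \<in> hatKG G d" "v \<in> hatKG G d" "u \<noteq> v"
  shows "\<exists>g\<in>supp (u - v). delta G d u v = d g \<and> (\<forall>h\<in>supp (u - v). d h \<le> d g)"
proof -
  from assms(4) obtain a where a: "u a \<noteq> v a" by (auto simp: fun_eq_iff)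
  have w: "u - v \<in> hatKG G d" using assms hatKG_diff by blast
  have aS: "a \<in> supp (u - v)" using a by (simp add: supp_def)
  then have da: "0 < d a" using w assms(1) by (auto simp: hatKG_def)
  let ?A = "{g \<in> supp (u - v). d a \<le> d g}"
  have fin: "finite (d ` ?A)" using w da by (auto simp: hatKG_def)
  have "d ` ?A \<noteq> {}" using aS by auto
  then have "Max (d ` ?A) \<in> d ` ?A" using fin by (rule Max_in[rotated])
  then obtain g where g: "g \<in> ?A" "Max (d ` ?A) = d g" by auto
  have ub: "d h \<le> d g" if "h \<in> supp (u - v)" for h
  proof (cases "d a \<le> d h")
    case True
    then have "d h \<le> Max (d ` ?A)" using that fin by (intro Max_ge) auto
    then show ?thesis using g by simp
  next
    case False
    then show ?thesis using g by auto
  qed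
  have "Sup (d ` supp (u - v)) = d g"
    by (rule cSup_eq_maximum) (use g ub in auto)
  then show ?thesis using g ub assms(2-4) by (auto simp: delta_def)
qed

lemma delta_KG:
  assumes "\<forall>g\<in>G. 0 < d g" "u \<in> KG G" "v \<in> KG G" "u \<noteq> v"
  shows "delta G d u v = Max {d g | g. (u - v) g \<noteq> 0}"
proof -
  have "finite (supp u \<union> supp v)" using assms by (auto simp: KG_def)
  then have fin: "finite (supp (u - v))"
    by (rule rev_finite_subset) (auto simp: supp_def)
  have "supp (u - v) \<noteq> {}" using assms(4) by (auto simp: supp_def fun_eq_iff)
  then have "Sup (d ` supp (u - v)) = Max (d ` supp (u - v))"
    using fin by (intro cSup_eq_Max) auto
  moreover have "d ` supp (u - v) = {d g | g. (u - v) g \<noteq> 0}" by (auto simp: supp_def)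
  ultimately show ?thesis using assms(2-4) KG_subset_hatKG by (fastforce simp: delta_def)
qed

lemma delta_less_iff:
  assumes "\<forall>g\<in>G. 0 < d g" "u \<in> hatKG G d" "v \<in> hatKG G d" "0 < \<epsilon>"
  shows "delta G d u v < \<epsilon> \<longleftrightarrow> (\<forall>g. u g \<noteq> v g \<longrightarrow> d g < \<epsilon>)"
proof (cases "u = v")
  case True
  then show ?thesis using assms by (simp add: delta_def)
next
  case False
  then obtain g where "g \<in> supp (u - v)" "delta G d u v = d g" "\<forall>h\<in>supp (u - v). d h \<le> d g"
    using delta_attained[OF assms(1-3)] by blast
  then show ?thesis by (auto simp: supp_def intro: le_less_trans)
qed

lemma Metric_space_hatKG:
  assumes "\<forall>g\<in>G. 0 < d g"
  shows "Metric_space (hatKG G d :: ('g \<Rightarrow> 'k::field) set) (delta G d)"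
proof
  fix u v w :: "'g \<Rightarrow> 'k"
  have pos: "0 < delta G d u v"
    if uv: "u \<in> hatKG G d" "v \<in> hatKG G d" "u \<noteq> v" for u v :: "'g \<Rightarrow> 'k"
  proof -
    obtain g where g: "g \<in> supp (u - v)" "delta G d u v = d g"
      using delta_attained[OF assms uv] by blast
    moreover have "supp (u - v) \<subseteq> G" using hatKG_diff[OF uv(1,2)] by (auto simp: hatKG_def)
    ultimately show ?thesis using assms by auto
  qed
  show nonneg: "0 \<le> delta G d u v" for u v :: "'g \<Rightarrow> 'k"
    using pos[of u v] by (cases "u \<in> hatKG G d \<and> v \<in> hatKG G d \<and> u \<noteq> v") (auto simp: delta_def)
  have "supp (u - v) = supp (v - u)" by (auto simp: supp_def)
  then show "delta G d u v = delta G d v u" by (auto simp: delta_def)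
  show "delta G d u v = 0 \<longleftrightarrow> u = v" if "u \<in> hatKG G d" "v \<in> hatKG G d"
    using pos[OF that] by (cases "u = v") (simp_all add: delta_def)
  assume H: "u \<in> hatKG G d" "v \<in> hatKG G d" "w \<in> hatKG G d"
  show "delta G d u w \<le> delta G d u v + delta G d v w"
  proof (cases "u = w")
    case True
    then show ?thesis using nonneg by (simp add: delta_def)
  next
    case False
    then obtain g where g: "g \<in> supp (u - w)" "delta G d u w = d g"
      using delta_attained[OF assms H(1,3)] by blast
    then have "u g \<noteq> v g \<or> v g \<noteq> w g" by (auto simp: supp_def)
    then show ?thesis
    proof
      assume n: "u g \<noteq> v g"
      then obtain h where "delta G d u v = d h" "\<forall>k\<in>supp (u - v). d k \<le> d h"
        using delta_attained[OF assms H(1,2)] by metis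
      then have "d g \<le> delta G d u v" using n by (auto simp: supp_def)
      then show ?thesis using g nonneg[of v w] by simp
    next
      assume n: "v g \<noteq> w g"
      then obtain h where "delta G d v w = d h" "\<forall>k\<in>supp (v - w). d k \<le> d h"
        using delta_attained[OF assms H(2,3)] by metis
      then have "d g \<le> delta G d v w" using n by (auto simp: supp_def)
      then show ?thesis using g nonneg[of u v] by simp
    qed
  qed
qed

lemma KG_dense:
  assumes "\<forall>g\<in>G. 0 < d g"
  shows "hat_topology G d closure_of KG G = (hatKG G d :: ('g \<Rightarrow> 'k::field) set)"
proof -
  interpret Metric_space "hatKG G d :: ('g \<Rightarrow> 'k) set" "delta G d"
    by (rule Metric_space_hatKG[OF assms])
  have "\<exists>w\<in>KG G. w \<in> mball v r" if v: "v \<in> hatKG G d" and r: "0 < r" for v :: "'g \<Rightarrow> 'k" and r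
  proof
    let ?w = "\<lambda>g. if r \<le> d g then v g else 0"
    have "supp ?w = {g \<in> supp v. r \<le> d g}" by (auto simp: supp_def)
    then show w: "?w \<in> KG G" using v r by (auto simp: KG_def hatKG_def)
    then have wh: "?w \<in> hatKG G d" using KG_subset_hatKG by blast
    have "delta G d v ?w < r"
      unfolding delta_less_iff[OF assms v wh r] by auto
    then show "?w \<in> mball v r" using v wh by simp
  qed
  then show ?thesis unfolding metric_closure_of by blast
qed

lemma hatKG_mcomplete:
  assumes "\<forall>g\<in>G. 0 < d g"
  shows "Metric_space.mcomplete (hatKG G d :: ('g \<Rightarrow> 'k::field) set) (delta G d)"
proof -
  interpret Metric_space "hatKG G d :: ('g \<Rightarrow> 'k) set" "delta G d"
    by (rule Metric_space_hatKG[OF assms])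
  show ?thesis unfolding mcomplete_def
  proof (intro allI impI)
    fix s :: "nat \<Rightarrow> 'g \<Rightarrow> 'k"
    assume C: "MCauchy s"
    then have sh: "s n \<in> hatKG G d" for n by (auto simp: MCauchy_def)
    have "\<exists>N. \<forall>n\<ge>N. \<forall>m\<ge>N. \<forall>g. s n g \<noteq> s m g \<longrightarrow> d g < e" if e: "0 < e" for e
    proof -
      obtain N where "\<forall>n m. N \<le> n \<longrightarrow> N \<le> m \<longrightarrow> delta G d (s n) (s m) < e"
        using C e unfolding MCauchy_def by meson
      then show ?thesis unfolding delta_less_iff[OF assms sh sh e] by blast
    qed
    then obtain N where N: "\<And>e n m g. \<lbrakk>0 < e; N e \<le> n; N e \<le> m; s n g \<noteq> s m g\<rbrakk> \<Longrightarrow> d g < e"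
      by metis
    define x where "x g = (if g \<in> G then s (N (d g)) g else 0)" for g
    have x: "s n g = x g" if "0 < e" "N e \<le> n" "e \<le> d g" for e n g
    proof (cases "g \<in> G")
      case True
      let ?m = "max n (N (d g))"
      have "s n g = s ?m g" using N[of e n ?m g] that by fastforce
      moreover have "s (N (d g)) g = s ?m g" using N[of "d g" "N (d g)" ?m g] assms True by fastforce
      ultimately show ?thesis using True by (simp add: x_def)
    next
      case False
      then show ?thesis using sh[of n] by (auto simp: hatKG_def supp_def x_def)
    qed
    have xh: "x \<in> hatKG G d"
      unfolding hatKG_def
    proof (clarsimp, intro conjI allI impI)
      show "supp x \<subseteq> G" by (auto simp: supp_def x_def split: if_splits)
      fix e :: real assume e: "0 < e"
      have "{g \<in> supp x. e \<le> d g} = {g \<in> supp (s (N e)). e \<le> d g}"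
        using x[OF e order_refl] by (auto simp: supp_def)
      then show "finite {g \<in> supp x. e \<le> d g}" using sh[of "N e"] e by (simp add: hatKG_def)
    qed
    have "delta G d (s n) x < e" if "0 < e" "N e \<le> n" for e n
      unfolding delta_less_iff[OF assms sh xh that(1)] using x[OF that] by force
    then have "limitin mtopology s x sequentially"
      unfolding limit_metric_sequentially using sh xh by blast
    then show "\<exists>x. limitin mtopology s x sequentially" by blast
  qed
qed

lemma continuous_coeff:
  assumes "\<forall>g\<in>G. 0 < d g" "g \<in> G"
  shows "continuous_map (hat_topology G d) (discrete_topology UNIV) (\<lambda>v :: 'g \<Rightarrow> 'k::field. v g)"
proof -
  interpret Metric_space "hatKG G d :: ('g \<Rightarrow> 'k) set" "delta G d"
    by (rule Metric_space_hatKG[OF assms(1)])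
  have pos: "0 < d g" using assms by blast
  have "openin mtopology {v \<in> hatKG G d. v g \<in> U}" for U :: "'k set"
    unfolding openin_mtopology
  proof (intro conjI allI impI)
    fix v :: "'g \<Rightarrow> 'k" assume v: "v \<in> {v \<in> hatKG G d. v g \<in> U}"
    have "w g = v g" if "w \<in> mball v (d g)" for w
    proof (rule ccontr)
      assume "w g \<noteq> v g"
      then have "v g \<noteq> w g" by simp
      moreover have "v \<in> hatKG G d" "w \<in> hatKG G d" "delta G d v w < d g" using that by auto
      ultimately have "d g < d g" using delta_less_iff[OF assms(1) _ _ pos, of v w] by blast
      then show False by simp
    qed
    then show "\<exists>r>0. mball v r \<subseteq> {v \<in> hatKG G d. v g \<in> U}"
      using v pos by (intro exI[of _ "d g"]) auto
  qed auto
  then show ?thesis by (auto simp: continuous_map_def)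
qed

end

theory Submission
  imports Defs
begin

text \<open>
  A vector of the completion has only finitely many coefficients on the basis elements \<open>g\<close> with
  \<open>\<epsilon> \<le> d g\<close>, those basis elements are well-ordered, and since \<open>d\<close> is non-decreasing they lie above
  all the others. Closeness for \<open>\<delta>\<close> means equality of the coefficients above some level \<open>\<epsilon>\<close>
  (\<open>agree\<close>), so every topological statement can be checked one level at a time, where rewriting
  behaves as for finite combinations of a well-ordered basis: replacing the greatest reducible basis element by
  smaller ones terminates (\<open>reduction_terminates\<close>).

  Continuity and the order condition on basis elements make a reduction operator triangular: it maps
  a vector supported below \<open>g\<close> to a vector supported below \<open>g\<close> (\<open>RO_lower\<close>). Hence it leaves
  untouched every coefficient at and above which only its normal forms occur (\<open>RO_fix\<close>), and it erases the
  greatest element of the support that is not a normal form (\<open>RO_kill\<close>).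

  The operator \<open>\<and>F\<close> exists because every closed subspace \<open>V\<close> is the kernel of a reduction operator
  (\<open>RO_with_kernel\<close>): each vector has a unique representative modulo \<open>V\<close> without leading elements of
  \<open>V\<close> in its support. It is the limit of reductions down to the levels \<open>1/(n+1)\<close>.

  Suppose that \<open>F\<close> is confluent. For any level, a vector \<open>v\<close> rewrites into a vector \<open>w\<close> whose
  basis elements above the level are in \<open>nf(F)\<close>, hence fixed by \<open>\<and>F\<close>. Since \<open>\<and>F\<close> is constant along rewriting, \<open>w\<close>
  agrees above the level with \<open>\<and>F(w) = \<and>F(v)\<close>. Thus \<open>v\<close> topologically rewrites into \<open>\<and>F(v)\<close>, and
  \<open>\<and>F(a)\<close> closes every fork that starts at \<open>a\<close>.

  Suppose conversely that the relation is \<open>\<delta>\<close>-confluent. Then the normal form of a vector above a level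
  is unique (\<open>normal_unique\<close>), and as the same operators can be applied to two summands at once
  (\<open>rew_parallel\<close>) it is additive. A vector of a kernel rewrites into 0, so a finite sum of such
  vectors has normal form 0 above every level. If some \<open>g \<in> nf(F)\<close> was not in \<open>nf(\<and>F)\<close>, then
  \<open>g - \<and>F(g)\<close> would be in the closure of the sum of the kernels, with leading element \<open>g\<close>. A finite sum
  of vectors of the kernels that is close enough to it has leading element \<open>g\<close> too. But no operator of
  \<open>F\<close> ever changes a leading coefficient at a common normal form, so its normal form is not 0.
\<close>

section \<open>Order and topology of the completed space\<close>

locale elimination =
  fixes G :: "'g::linorder set" and d :: "'g \<Rightarrow> real"
  assumes d_pos: "\<forall>g\<in>G. 0 < d g"
    and elimination: "elimination_map G d"
begin

abbreviation hat :: "('g \<Rightarrow> 'k::field) set" where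
  "hat \<equiv> hatKG G d"

text \<open>On the completion and for \<open>\<epsilon> > 0\<close>, this is the inequality \<open>\<delta>(u, v) < \<epsilon>\<close>; see \<open>in_mball_iff\<close>.\<close>

definition agree :: "real \<Rightarrow> ('g \<Rightarrow> 'k) \<Rightarrow> ('g \<Rightarrow> 'k) \<Rightarrow> bool" where
  "agree \<epsilon> u v \<longleftrightarrow> (\<forall>g\<in>G. \<epsilon> \<le> d g \<longrightarrow> u g = v g)"

definition coeffs_on :: "'g set \<Rightarrow> ('g \<Rightarrow> 'k::field) \<Rightarrow> 'g \<Rightarrow> 'k" where
  "coeffs_on A v = (\<lambda>g. if g \<in> A then v g else 0)"

definition leads :: "('g \<Rightarrow> 'k::field) \<Rightarrow> 'g \<Rightarrow> bool" where
  "leads v g \<longleftrightarrow> v g \<noteq> 0 \<and> (\<forall>h>g. v h = 0)"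

lemma d_mono: "g \<in> G \<Longrightarrow> h \<in> G \<Longrightarrow> g \<le> h \<Longrightarrow> d g \<le> d h"
  using elimination by (auto simp: elimination_map_def mono_on_def)

lemma hat_outside: "v \<in> hat \<Longrightarrow> g \<notin> G \<Longrightarrow> v g = 0"
  by (auto simp: hatKG_def supp_def)

lemma zero_hat [simp]: "0 \<in> hat"
  by (simp add: hatKG_def supp_def)

lemma coeffs_on_hat: "v \<in> hat \<Longrightarrow> coeffs_on A v \<in> hat"
  by (erule hatKG_mono) (auto simp: supp_def coeffs_on_def)

lemma basis_vec_hat: "g \<in> G \<Longrightarrow> (basis_vec g :: 'g \<Rightarrow> 'k::field) \<in> hat"
proof -
  assume "g \<in> G"
  moreover have "supp (basis_vec g :: 'g \<Rightarrow> 'k) = {g}" by (auto simp: supp_def basis_vec_def)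
  ultimately have "(basis_vec g :: 'g \<Rightarrow> 'k) \<in> KG G" by (simp add: KG_def)
  then show ?thesis using KG_subset_hatKG by blast
qed

lemma hat_finite_above:
  assumes "v \<in> hat" "g \<in> G"
  shows "finite {h \<in> supp v. g \<le> h}"
proof (rule finite_subset)
  show "{h \<in> supp v. g \<le> h} \<subseteq> {h \<in> supp v. d g \<le> d h}"
    using assms d_mono by (auto simp: hatKG_def)
  show "finite {h \<in> supp v. d g \<le> d h}"
    using assms d_pos by (auto simp: hatKG_def)
qed

text \<open>
  The support may be infinite and without a least element, but the part of it above any of its
  elements is finite.
\<close>

lemma greatest_in_supp:
  assumes "v \<in> hat" "g \<in> supp v" "P g"
  shows "\<exists>h\<in>supp v. P h \<and> (\<forall>k\<in>supp v. P k \<longrightarrow> k \<le> h)"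
proof -
  let ?A = "{h \<in> {h \<in> supp v. g \<le> h}. P h}"
  have "g \<in> G" using assms by (auto simp: hatKG_def)
  then have fin: "finite ?A" using hat_finite_above[OF assms(1)] by (auto intro: finite_subset[rotated])
  have "g \<in> ?A" using assms by simp
  then have m: "Max ?A \<in> ?A" "g \<le> Max ?A" using fin Max_in[of ?A] Max_ge[of ?A g] by blast+
  have "k \<le> Max ?A" if "k \<in> supp v" "P k" for k
    using that m(2) fin by (cases "g \<le> k") auto
  then show ?thesis using m(1) by (intro bexI[of _ "Max ?A"]) auto
qed

text \<open>
  Only finitely many layers meet the set, and \<open>d\<close> being non-decreasing, a layer of higher index lies
  entirely below those of lower index: a least element is found in the lowest layer that is met.
\<close>

lemma wfp_on_above:
  assumes "0 < \<epsilon>"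
  shows "wfp_on {g \<in> G. \<epsilon> \<le> d g} (<)"
proof -
  have wf: "wfp_on {g \<in> G. 1 / real (Suc n) \<le> d g} (<)" for n
  proof (induction n)
    case 0
    have "{g \<in> G. 1 / real (Suc 0) \<le> d g} = layer G d 1" by (auto simp: layer_def)
    moreover have "wfp_on (layer G d 1) (<)"
      using elimination unfolding elimination_map_def by blast
    ultimately show ?case by simp
  next
    case (Suc n)
    let ?H = "{g \<in> G. 1 / real (Suc n) \<le> d g}" and ?L = "layer G d (Suc (Suc n))"
    have L: "wfp_on ?L (<)"
      using elimination unfolding elimination_map_def by simp
    show ?case
      unfolding wfp_on_iff_ex_minimal
    proof (intro allI impI)
      fix B assume B: "B \<subseteq> {g \<in> G. 1 / real (Suc (Suc n)) \<le> d g}" "B \<noteq> {}"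
      have cover: "b \<in> ?L \<or> b \<in> ?H" if "b \<in> B" for b
        using B that by (auto simp: layer_def not_le)
      show "\<exists>z\<in>B. \<forall>y. y < z \<longrightarrow> y \<notin> B"
      proof (cases "B \<inter> ?L = {}")
        case True
        then have "B \<subseteq> ?H" using cover by blast
        then show ?thesis using Suc.IH B(2) unfolding wfp_on_iff_ex_minimal by blast
      next
        case False
        then obtain z where z: "z \<in> B \<inter> ?L" "\<forall>y. y < z \<longrightarrow> y \<notin> B \<inter> ?L"
          using L unfolding wfp_on_iff_ex_minimal by (metis Int_lower2)
        have "y \<notin> B" if "y < z" for y
        proof
          assume y: "y \<in> B"
          then have "y \<in> ?H" using z that cover by blast
          moreover have "d y \<le> d z" using y z B that by (intro d_mono) auto
          ultimately show False using z(1) by (auto simp: layer_def)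
        qed
        then show ?thesis using z by blast
      qed
    qed
  qed
  obtain n where "1 / real (Suc n) < \<epsilon>" using nat_approx_posE[OF assms] by blast
  then show ?thesis by (intro wfp_on_subset[OF wf[of n]]) auto
qed

lemma agree_refl: "agree \<epsilon> v v"
  by (auto simp: agree_def)

lemma in_mball_iff:
  fixes u v :: "'g \<Rightarrow> 'k::field"
  assumes "u \<in> hat" "0 < r"
  shows "v \<in> Metric_space.mball hat (delta G d) u r \<longleftrightarrow> v \<in> hat \<and> agree r u v"
proof -
  interpret Metric_space "hat :: ('g \<Rightarrow> 'k) set" "delta G d"
    by (rule Metric_space_hatKG[OF d_pos])
  have "delta G d u v < r \<longleftrightarrow> agree r u v" if "v \<in> hat"
    unfolding delta_less_iff[OF d_pos assms(1) that assms(2)] agree_def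
    using hat_outside[OF assms(1)] hat_outside[OF that] by (metis not_le)
  then show ?thesis using assms by auto
qed

lemma in_closure_iff:
  fixes S :: "('g \<Rightarrow> 'k::field) set"
  assumes "S \<subseteq> hat"
  shows "v \<in> hat_topology G d closure_of S \<longleftrightarrow> v \<in> hat \<and> (\<forall>r>0. \<exists>u\<in>S. agree r v u)"
proof -
  interpret Metric_space "hat :: ('g \<Rightarrow> 'k) set" "delta G d"
    by (rule Metric_space_hatKG[OF d_pos])
  have "(\<exists>u\<in>S. u \<in> mball v r) \<longleftrightarrow> (\<exists>u\<in>S. agree r v u)" if "v \<in> hat" "0 < r" for r
    using in_mball_iff[OF that] assms by blast
  then show ?thesis unfolding metric_closure_of by blast
qed

lemma open_neighbourhood_iff:
  fixes w :: "'g \<Rightarrow> 'k::field"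
  assumes "w \<in> hat"
  shows "(\<forall>U. openin (hat_topology G d) U \<and> w \<in> U \<longrightarrow> (\<exists>u\<in>U. P u)) \<longleftrightarrow>
    (\<forall>r>0. \<exists>u\<in>hat. agree r w u \<and> P u)"
proof -
  interpret Metric_space "hat :: ('g \<Rightarrow> 'k) set" "delta G d"
    by (rule Metric_space_hatKG[OF d_pos])
  have "(\<forall>U. openin mtopology U \<and> w \<in> U \<longrightarrow> (\<exists>u\<in>U. P u)) \<longleftrightarrow>
      (\<forall>r>0. \<exists>u\<in>mball w r. P u)"
  proof (intro iffI allI impI)
    fix r :: real
    assume "\<forall>U. openin mtopology U \<and> w \<in> U \<longrightarrow> (\<exists>u\<in>U. P u)" "0 < r"
    then show "\<exists>u\<in>mball w r. P u" using assms openin_mball centre_in_mball_iff by blast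
  next
    fix U assume *: "\<forall>r>0. \<exists>u\<in>mball w r. P u" "openin mtopology U \<and> w \<in> U"
    then obtain r where "r > 0" "mball w r \<subseteq> U" unfolding openin_mtopology by blast
    then show "\<exists>u\<in>U. P u" using * by blast
  qed
  moreover have "(\<exists>u\<in>mball w r. P u) \<longleftrightarrow> (\<exists>u\<in>hat. agree r w u \<and> P u)" if "0 < r" for r
    using in_mball_iff[OF assms that] by blast
  ultimately show ?thesis by simp
qed

text \<open>
  The two directions serve different ends: one turns the continuity of a given operator into a
  statement on coefficients, the other proves that the operator with a prescribed kernel is continuous.
\<close>

lemma continuous_map_agree:
  fixes T :: "('g \<Rightarrow> 'k::field) \<Rightarrow> ('g \<Rightarrow> 'k)"
  shows "continuous_map (hat_topology G d) (hat_topology G d) T \<longleftrightarrow> T \<in> hat \<rightarrow> hat \<and>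
    (\<forall>u\<in>hat. \<forall>\<epsilon>>0. \<exists>\<eta>>0. \<forall>v\<in>hat. agree \<eta> u v \<longrightarrow> agree \<epsilon> (T u) (T v))"
proof -
  interpret Metric_space "hat :: ('g \<Rightarrow> 'k) set" "delta G d"
    by (rule Metric_space_hatKG[OF d_pos])
  have ball: "delta G d u v < r \<longleftrightarrow> agree r u v" if "u \<in> hat" "v \<in> hat" "0 < r" for u v :: "'g \<Rightarrow> 'k" and r
    using in_mball_iff[OF that(1,3)] that by auto
  show ?thesis (is "?C \<longleftrightarrow> ?A")
  proof
    assume C: ?C
    then have T: "T \<in> hat \<rightarrow> hat" using continuous_map_funspace by fastforce
    have "\<exists>\<eta>>0. \<forall>v\<in>hat. agree \<eta> u v \<longrightarrow> agree \<epsilon> (T u) (T v)" if u: "u \<in> hat" and e: "0 < \<epsilon>" for u \<epsilon>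
    proof -
      have Tu: "T u \<in> hat" using T u by blast
      have "openin mtopology (mball (T u) \<epsilon>)" "T u \<in> mball (T u) \<epsilon>" using Tu e by auto
      then obtain r where "r > 0" "\<forall>x. x \<in> hat \<and> delta G d u x < r \<longrightarrow> T x \<in> mball (T u) \<epsilon>"
        using C u unfolding continuous_map_from_metric by meson
      then have "agree \<epsilon> (T u) (T v)" if "v \<in> hat" "agree r u v" for v
        using ball[OF u that(1) \<open>r > 0\<close>] in_mball_iff[OF Tu e] that by simp
      then show ?thesis using \<open>r > 0\<close> by blast
    qed
    then show ?A using T by blast
  next
    assume A: ?A
    then have "T \<in> hat \<rightarrow> hat" by (rule conjunct1)
    then have T: "T x \<in> hat" if "x \<in> hat" for x using that by (rule funcset_mem)
    show ?C
      unfolding continuous_map_to_metric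
    proof (intro ballI allI impI)
      fix u and \<epsilon> :: real assume "u \<in> topspace mtopology" and e: "0 < \<epsilon>"
      then have u: "u \<in> hat" by simp
      then obtain r where r: "r > 0" "\<forall>v\<in>hat. agree r u v \<longrightarrow> agree \<epsilon> (T u) (T v)"
        using A[THEN conjunct2] e by meson
      have "T y \<in> mball (T u) \<epsilon>" if "y \<in> mball u r" for y
        using that r(2) T[of y] unfolding in_mball_iff[OF u r(1)] in_mball_iff[OF T[OF u] e] by simp
      then show "\<exists>U. openin mtopology U \<and> u \<in> U \<and> (\<forall>y\<in>U. T y \<in> mball (T u) \<epsilon>)"
        using u r by (intro exI[of _ "mball u r"]) auto
    qed
  qed
qed

section \<open>Reduction down to a given level\<close>

text \<open>
  Call an element of the support bad if it is above the level \<open>\<epsilon>\<close> and outside \<open>N\<close>. A step applied at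
  the greatest bad element changes nothing above it, so the greatest bad element decreases strictly
  in a well-ordered set. The last conjunct bounds the region that the steps modify; it makes the
  iteration over the levels converge. The lemma is used with rewriting by \<open>F\<close> as \<open>R\<close>, and with
  congruence modulo a closed subspace.
\<close>

lemma reduction_terminates:
  fixes R :: "('g \<Rightarrow> 'k::field) \<Rightarrow> ('g \<Rightarrow> 'k) \<Rightarrow> bool"
  assumes step: "\<And>v h. v \<in> hat \<Longrightarrow> h \<in> supp v \<Longrightarrow> h \<notin> N \<Longrightarrow> (\<forall>k\<in>supp v. h < k \<longrightarrow> k \<in> N) \<Longrightarrow>
      \<exists>w\<in>hat. R v w \<and> w h = 0 \<and> (\<forall>k>h. w k = v k)"
    and "v \<in> hat" "0 < \<epsilon>"
  shows "\<exists>w\<in>hat. R\<^sup>*\<^sup>* v w \<and> (\<forall>g\<in>supp w. \<epsilon> \<le> d g \<longrightarrow> g \<in> N) \<and>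
      (\<forall>g. (\<forall>h\<in>supp v. \<epsilon> \<le> d h \<longrightarrow> h \<notin> N \<longrightarrow> h < g) \<longrightarrow> w g = v g)"
proof -
  let ?bad = "\<lambda>v h. h \<in> supp v \<and> \<epsilon> \<le> d h \<and> h \<notin> N"
  let ?concl = "\<lambda>v. \<exists>w\<in>hat. R\<^sup>*\<^sup>* v w \<and> (\<forall>g. \<not> ?bad w g) \<and>
      (\<forall>g. (\<forall>h. ?bad v h \<longrightarrow> h < g) \<longrightarrow> w g = v g)"
  have main: "?concl v" if "h \<in> {g \<in> G. \<epsilon> \<le> d g}" "v \<in> hat" "?bad v h" "\<forall>k. ?bad v k \<longrightarrow> k \<le> h" for h v
    using wfp_on_above[OF \<open>0 < \<epsilon>\<close>] that
  proof (induction h arbitrary: v rule: wfp_on_induct[consumes 2, case_names less])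
    case (less h v)
    have "\<forall>k\<in>supp v. h < k \<longrightarrow> k \<in> N"
    proof (intro ballI impI, rule ccontr)
      fix k assume k: "k \<in> supp v" "h < k" "k \<notin> N"
      moreover have "d h \<le> d k" using less.hyps(1) less.prems k by (intro d_mono) (auto simp: hatKG_def)
      ultimately show False using less.prems by fastforce
    qed
    then obtain v1 where v1: "v1 \<in> hat" "R v v1" "v1 h = 0" "\<forall>k>h. v1 k = v k"
      using step less.prems by blast
    have below: "k < h" if "?bad v1 k" for k
    proof (rule ccontr)
      assume "\<not> k < h"
      then consider "k = h" | "h < k" by fastforce
      then show False
      proof cases
        case 1 then show False using that v1 by (simp add: supp_def)
      next
        case 2
        then have "?bad v k" using that v1 by (simp add: supp_def)
        then show False using less.prems 2 by fastforce
      qed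
    qed
    have "?concl v1"
    proof (cases "\<exists>k. ?bad v1 k")
      case True
      then obtain k where k: "?bad v1 k" "\<forall>l. ?bad v1 l \<longrightarrow> l \<le> k"
        using greatest_in_supp[OF v1(1), of _ "?bad v1"] by blast
      then have "k \<in> {g \<in> G. \<epsilon> \<le> d g}" using v1(1) by (auto simp: hatKG_def)
      then show ?thesis using less.IH[OF _ below[OF k(1)] v1(1) k] by blast
    next
      case False
      then show ?thesis using v1(1) by blast
    qed
    then obtain w where w: "w \<in> hat" "R\<^sup>*\<^sup>* v1 w" "\<forall>g. \<not> ?bad w g"
        "\<forall>g. (\<forall>h. ?bad v1 h \<longrightarrow> h < g) \<longrightarrow> w g = v1 g"
      by blast
    have "w g = v g" if "\<forall>l. ?bad v l \<longrightarrow> l < g" for g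
    proof -
      have "h < g" using that less.prems by blast
      then show ?thesis using w(4) below v1(4) by (metis less_trans)
    qed
    then show ?case using w v1(2) by (meson converse_rtranclp_into_rtranclp)
  qed
  have "?concl v"
  proof (cases "\<exists>k. ?bad v k")
    case True
    then obtain k where k: "?bad v k" "\<forall>l. ?bad v l \<longrightarrow> l \<le> k"
      using greatest_in_supp[OF \<open>v \<in> hat\<close>, of _ "?bad v"] by blast
    then show ?thesis using \<open>v \<in> hat\<close> by (intro main[of k]) (auto simp: hatKG_def)
  next
    case False
    then show ?thesis using \<open>v \<in> hat\<close> by blast
  qed
  then show ?thesis by blast
qed

section \<open>Reduction operators are triangular\<close>

lemma
  assumes "T \<in> RO G d"
  shows RO_hat: "v \<in> hat \<Longrightarrow> T v \<in> hat"
    and RO_add: "u \<in> hat \<Longrightarrow> v \<in> hat \<Longrightarrow> T (u + v) = T u + T v"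
    and RO_scal: "v \<in> hat \<Longrightarrow> T (scal c v) = scal c (T v)"
    and RO_idem: "v \<in> hat \<Longrightarrow> T (T v) = T v"
    and RO_continuous: "continuous_map (hat_topology G d) (hat_topology G d) T"
    and RO_basis: "g \<in> G \<Longrightarrow> T (basis_vec g) \<noteq> basis_vec g \<Longrightarrow> T (basis_vec g) h \<noteq> 0 \<Longrightarrow> h < g"
proof -
  note T1 = assms[unfolded RO_def mem_Collect_eq supp_def]
  note T2 = T1[THEN conjunct2] note T3 = T2[THEN conjunct2] note T4 = T3[THEN conjunct2]
  note T5 = T4[THEN conjunct2] note T6 = T5[THEN conjunct2]
  show "v \<in> hat \<Longrightarrow> T v \<in> hat" by (rule PiE_mem[OF T1[THEN conjunct1]])
  show "u \<in> hat \<Longrightarrow> v \<in> hat \<Longrightarrow> T (u + v) = T u + T v"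
    by (rule T2[THEN conjunct1, THEN bspec, THEN bspec])
  show "v \<in> hat \<Longrightarrow> T (scal c v) = scal c (T v)"
    by (rule T3[THEN conjunct1, THEN spec, THEN bspec])
  show "v \<in> hat \<Longrightarrow> T (T v) = T v"
    by (rule T4[THEN conjunct1, THEN bspec])
  show "continuous_map (hat_topology G d) (hat_topology G d) T"
    by (rule T5[THEN conjunct1])
  show "g \<in> G \<Longrightarrow> T (basis_vec g) \<noteq> basis_vec g \<Longrightarrow> T (basis_vec g) h \<noteq> 0 \<Longrightarrow> h < g"
    using T6 by blast
qed

lemma RO_zero:
  assumes "T \<in> RO G d"
  shows "T 0 = 0"
proof -
  have "T (0 + 0) = T 0 + T 0" by (rule RO_add[OF assms]) simp_all
  then show ?thesis by simp
qed

lemma RO_diff: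
  assumes "T \<in> RO G d" "u \<in> hat" "v \<in> hat"
  shows "T (u - v) = T u - T v"
proof -
  have "T ((u - v) + v) = T (u - v) + T v"
    by (rule RO_add[OF assms(1)]) (use assms hatKG_diff in auto)
  then show ?thesis by simp
qed

lemma RO_scal_basis_add:
  assumes "T \<in> RO G d" "g \<in> G" "u \<in> hat"
  shows "T (scal c (basis_vec g) + u) = scal c (T (basis_vec g)) + T u"
proof -
  have b: "basis_vec g \<in> hat" by (rule basis_vec_hat[OF assms(2)])
  have "T (scal c (basis_vec g) + u) = T (scal c (basis_vec g)) + T u"
    by (rule RO_add[OF assms(1) hatKG_scal[OF b] assms(3)])
  then show ?thesis unfolding RO_scal[OF assms(1) b] .
qed

lemma finite_supp_induct [consumes 2, case_names zero add]:
  fixes v :: "'g \<Rightarrow> 'k::field"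
  assumes "finite (supp v)" "v \<in> hat"
    and zero: "P 0"
    and add: "\<And>g c u. g \<in> supp v \<Longrightarrow> u \<in> hat \<Longrightarrow> P u \<Longrightarrow> P (scal c (basis_vec g) + u)"
  shows "P v"
proof -
  have "P (coeffs_on A v)" if "finite A" "A \<subseteq> supp v" for A
    using that
  proof (induction A rule: finite_induct)
    case empty
    have "coeffs_on {} v = 0" by (rule ext) (simp add: coeffs_on_def)
    show ?case unfolding \<open>coeffs_on {} v = 0\<close> by (rule zero)
  next
    case (insert a A)
    have "coeffs_on (insert a A) v = scal (v a) (basis_vec a) + coeffs_on A v"
      using insert.hyps(2) by (intro ext) (auto simp: coeffs_on_def scal_def basis_vec_def)
    moreover have "P (scal (v a) (basis_vec a) + coeffs_on A v)"
      using insert.prems by (intro add coeffs_on_hat assms(2) insert.IH) auto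
    ultimately show ?case by (simp only:)
  qed
  then have "P (coeffs_on (supp v) v)" using assms(1) by blast
  moreover have "coeffs_on (supp v) v = v" by (rule ext) (simp add: coeffs_on_def supp_def)
  ultimately show ?thesis by (simp only:)
qed

text \<open>
  For a vector with finite support this is the order condition on the images of basis elements. The
  general case reduces to it by continuity: the coefficients of \<open>v\<close> at a sufficiently low level do not
  contribute to the coefficient of \<open>T v\<close> at \<open>h\<close>.
\<close>

lemma RO_lower:
  assumes "T \<in> RO G d" "v \<in> hat" "g \<in> G" and low: "\<forall>h\<ge>g. v h = 0" and "g \<le> h"
  shows "T v h = 0"
proof (cases "h \<in> G")
  case False
  then show ?thesis using hat_outside RO_hat assms by blast
next
  case True
  then have "0 < d h" using d_pos by blast
  then obtain \<eta> where \<eta>: "0 < \<eta>" "\<And>u. u \<in> hat \<Longrightarrow> agree \<eta> 0 u \<Longrightarrow> agree (d h) (T 0) (T u)"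
    using RO_continuous[OF assms(1)] zero_hat unfolding continuous_map_agree by meson
  let ?a = "coeffs_on {k. \<eta> \<le> d k} v" and ?b = "coeffs_on {k. \<not> \<eta> \<le> d k} v"
  have ab: "?a \<in> hat" "?b \<in> hat" using coeffs_on_hat assms(2) by blast+
  have "supp ?a = {k \<in> supp v. \<eta> \<le> d k}" by (auto simp: coeffs_on_def supp_def)
  then have fin: "finite (supp ?a)" using assms(2) \<eta>(1) by (auto simp: hatKG_def)
  have sub: "k \<in> G \<and> k < h" if "k \<in> supp ?a" for k
    using that hat_outside[OF assms(2)] low \<open>g \<le> h\<close>
    by (fastforce simp: supp_def coeffs_on_def split: if_splits)
  have "T ?a h = 0"
    using fin ab(1)
  proof (induction rule: finite_supp_induct)
    case zero
    show ?case unfolding RO_zero[OF assms(1)] by simp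
  next
    case (add k c u)
    have lin: "T (scal c (basis_vec k) + u) = scal c (T (basis_vec k)) + T u"
      using RO_scal_basis_add[OF assms(1)] sub add by blast
    have "T (basis_vec k) h = 0"
    proof (cases "T (basis_vec k) = basis_vec k")
      case True
      then show ?thesis using sub add by (auto simp: basis_vec_def)
    next
      case False
      then show ?thesis using RO_basis[OF assms(1), of k h] sub add by force
    qed
    then show ?case unfolding lin using add by (simp add: scal_def)
  qed
  moreover have "agree \<eta> 0 ?b" by (simp add: agree_def coeffs_on_def)
  then have "T ?b h = 0" using \<eta>(2)[OF ab(2)] True RO_zero[OF assms(1)] by (auto simp: agree_def)
  moreover have "v = ?a + ?b" by (rule ext) (simp add: coeffs_on_def)
  then have "T v = T ?a + T ?b" using RO_add[OF assms(1) ab] by simp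
  ultimately show ?thesis by simp
qed

lemma RO_fixes_finite:
  assumes "T \<in> RO G d" "v \<in> hat" "finite (supp v)" "supp v \<subseteq> nf G T"
  shows "T v = v"
  using assms(3,2)
proof (induction rule: finite_supp_induct)
  case zero
  then show ?case using RO_zero assms by blast
next
  case (add g c u)
  then have "g \<in> G" "T (basis_vec g) = basis_vec g" using assms(4) by (auto simp: nf_def)
  then show ?case using add RO_scal_basis_add[OF assms(1)] by (simp only:)
qed

text \<open>
  The part of \<open>v\<close> from \<open>g\<close> upwards is a finite combination of normal forms, and the image of the rest
  stays below \<open>g\<close>.
\<close>

lemma RO_fix:
  assumes T: "T \<in> RO G d" and v: "v \<in> hat" and "g \<in> G"
    and nf: "\<forall>h\<ge>g. v h \<noteq> 0 \<longrightarrow> h \<in> nf G T" and "g \<le> h"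
  shows "T v h = v h"
proof -
  let ?a = "coeffs_on {g..} v" and ?b = "coeffs_on {..<g} v"
  have ab: "?a \<in> hat" "?b \<in> hat" using coeffs_on_hat v by blast+
  have "supp ?a = {k \<in> supp v. g \<le> k}" by (auto simp: coeffs_on_def supp_def)
  then have "finite (supp ?a)" using hat_finite_above[OF v \<open>g \<in> G\<close>] by simp
  moreover have "supp ?a \<subseteq> nf G T" using nf by (auto simp: coeffs_on_def supp_def)
  ultimately have "T ?a = ?a" using RO_fixes_finite T ab by blast
  moreover have "T ?b h = 0"
    by (rule RO_lower[OF T ab(2) \<open>g \<in> G\<close> _ \<open>g \<le> h\<close>]) (auto simp: coeffs_on_def)
  moreover have "v = ?a + ?b" by (rule ext) (auto simp: coeffs_on_def)
  then have "T v = T ?a + T ?b" using RO_add[OF T ab] by simp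
  ultimately show ?thesis using \<open>g \<le> h\<close> by (simp add: coeffs_on_def)
qed

text \<open>This is the reduction step that \<open>reduction_terminates\<close> iterates.\<close>

lemma RO_kill:
  fixes v :: "'g \<Rightarrow> 'k::field"
  assumes T: "T \<in> RO G d" and v: "v \<in> hat" and g: "g \<in> G" "g \<notin> nf G T"
    and nf: "\<forall>h>g. v h \<noteq> 0 \<longrightarrow> h \<in> nf G T"
  shows "T v g = 0" "g < h \<Longrightarrow> T v h = v h"
proof -
  let ?e = "scal (v g) (basis_vec g) "
  let ?r = "v - ?e"
  have e: "?e \<in> hat" "?r \<in> hat" using hatKG_scal[OF basis_vec_hat] hatKG_diff v g by blast+
  have r: "?r k = (if k = g then 0 else v k)" for k by (simp add: scal_def basis_vec_def)
  have "T ?r h = ?r h" if "g \<le> h" for h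
    by (rule RO_fix[OF T e(2) g(1) _ that]) (use nf in \<open>simp only: r; auto\<close>)
  moreover have "T ?e h = 0" if "g \<le> h" for h :: 'g
  proof -
    have "T (basis_vec g) \<noteq> basis_vec g" using g by (simp add: nf_def)
    then have "T (basis_vec g) h = 0" using RO_basis[OF T g(1), of h] that by force
    then show ?thesis using RO_scal[OF T basis_vec_hat[OF g(1)]] by (simp add: scal_def)
  qed
  moreover have "v = ?r + ?e" by simp
  then have "T v = T ?r + T ?e" using RO_add[OF T e(2,1)] by simp
  ultimately have "T v h = ?r h" if "g \<le> h" for h using that by simp
  then have "T v h = (if h = g then 0 else v h)" if "g \<le> h" for h using that by (simp only: r)
  then show "T v g = 0" "g < h \<Longrightarrow> T v h = v h" by auto
qed

section \<open>Operators with a prescribed kernel\<close>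

text \<open>The last conjunct is topological closedness, in terms of levels.\<close>

definition closed_subspace :: "('g \<Rightarrow> 'k::field) set \<Rightarrow> bool" where
  "closed_subspace V \<longleftrightarrow> V \<subseteq> hat \<and> 0 \<in> V \<and> (\<forall>u\<in>V. \<forall>v\<in>V. u + v \<in> V) \<and>
     (\<forall>c. \<forall>v\<in>V. scal c v \<in> V) \<and> (\<forall>v\<in>hat. (\<forall>r>0. \<exists>u\<in>V. agree r v u) \<longrightarrow> v \<in> V)"

definition lead_set :: "('g \<Rightarrow> 'k::field) set \<Rightarrow> 'g set" where
  "lead_set V = {g. \<exists>v\<in>V. leads v g}"

lemma
  assumes "closed_subspace V"
  shows subspace_hat: "v \<in> V \<Longrightarrow> v \<in> hat"
    and subspace_zero: "0 \<in> V"
    and subspace_add: "u \<in> V \<Longrightarrow> v \<in> V \<Longrightarrow> u + v \<in> V"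
    and subspace_scal: "v \<in> V \<Longrightarrow> scal c v \<in> V"
    and subspace_closed: "v \<in> hat \<Longrightarrow> (\<And>r. 0 < r \<Longrightarrow> \<exists>u\<in>V. agree r v u) \<Longrightarrow> v \<in> V"
proof -
  note V1 = assms[unfolded closed_subspace_def]
  note V2 = V1[THEN conjunct2] note V3 = V2[THEN conjunct2] note V4 = V3[THEN conjunct2]
  show "v \<in> V \<Longrightarrow> v \<in> hat" by (rule subsetD[OF V1[THEN conjunct1]])
  show "0 \<in> V" by (rule V2[THEN conjunct1])
  show "u \<in> V \<Longrightarrow> v \<in> V \<Longrightarrow> u + v \<in> V" by (rule V3[THEN conjunct1, THEN bspec, THEN bspec])
  show "v \<in> V \<Longrightarrow> scal c v \<in> V" by (rule V4[THEN conjunct1, THEN spec, THEN bspec])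
  show "v \<in> hat \<Longrightarrow> (\<And>r. 0 < r \<Longrightarrow> \<exists>u\<in>V. agree r v u) \<Longrightarrow> v \<in> V"
    by (rule V4[THEN conjunct2, THEN bspec, THEN mp]) blast+
qed

lemma subspace_diff:
  assumes "closed_subspace V" "u \<in> V" "v \<in> V"
  shows "u - v \<in> V"
proof -
  have "u - v = u + scal (-1) v" by (rule ext) (simp add: scal_def)
  then show ?thesis
    using subspace_add[OF assms(1,2) subspace_scal[OF assms(1,3)]] by (simp only:)
qed

lemma leads_exists:
  assumes "v \<in> hat" "v \<noteq> 0"
  shows "\<exists>g. leads v g"
proof -
  obtain g where "v g \<noteq> 0" using assms(2) by (metis ext zero_fun_apply)
  then obtain h where h: "h \<in> supp v" "\<forall>k\<in>supp v. k \<le> h"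
    using greatest_in_supp[OF assms(1), of g "\<lambda>_. True"] by (auto simp: supp_def)
  then have "leads v h" by (auto simp: leads_def supp_def)
  then show ?thesis by blast
qed

text \<open>
  Division by \<open>V\<close>, truncated at a level: a leading element \<open>h\<close> of some \<open>e \<in> V\<close> is removed from the support
  by subtracting a multiple of \<open>e\<close>.
\<close>

lemma remainder_above_level:
  fixes V :: "('g \<Rightarrow> 'k::field) set"
  assumes V: "closed_subspace V" and "v \<in> hat" "0 < \<epsilon>"
  shows "\<exists>w\<in>hat. v - w \<in> V \<and> (\<forall>g\<in>supp w. \<epsilon> \<le> d g \<longrightarrow> g \<notin> lead_set V) \<and>
      (\<forall>g. (\<forall>h\<in>supp v. \<epsilon> \<le> d h \<longrightarrow> h \<in> lead_set V \<longrightarrow> h < g) \<longrightarrow> w g = v g)"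
proof -
  let ?R = "\<lambda>v w. v - w \<in> V"
  have step: "\<exists>w\<in>hat. ?R v w \<and> w h = 0 \<and> (\<forall>k>h. w k = v k)"
    if v: "v \<in> hat" and h: "h \<notin> - lead_set V" for v h
  proof -
    from h obtain e where e: "e \<in> V" "leads e h" by (auto simp: lead_set_def)
    let ?s = "scal (v h / e h) e"
    have s: "?s \<in> V" by (rule subspace_scal[OF V e(1)])
    have "v - ?s \<in> hat" by (rule hatKG_diff[OF v subspace_hat[OF V s]])
    moreover have "v - (v - ?s) = ?s" by (rule ext) simp
    moreover have "(v - ?s) h = 0" "\<forall>k>h. (v - ?s) k = v k"
      using e(2) by (auto simp: leads_def scal_def)
    ultimately show ?thesis using s by (intro bexI[of _ "v - ?s"]) (simp_all only: simp_thms)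
  qed
  have trans: "v - w \<in> V" if "?R\<^sup>*\<^sup>* v w" for w
    using that
  proof (induction rule: rtranclp_induct)
    case base
    have "v - v = 0" by (rule ext) simp
    then show ?case using subspace_zero[OF V] by (simp only:)
  next
    case (step x y)
    have "v - y = (v - x) + (x - y)" by (rule ext) simp
    then show ?case using subspace_add[OF V step.IH step.hyps(2)] by (simp only:)
  qed
  obtain w where "w \<in> hat" "?R\<^sup>*\<^sup>* v w" "\<forall>g\<in>supp w. \<epsilon> \<le> d g \<longrightarrow> g \<in> - lead_set V"
      "\<forall>g. (\<forall>h\<in>supp v. \<epsilon> \<le> d h \<longrightarrow> h \<notin> - lead_set V \<longrightarrow> h < g) \<longrightarrow> w g = v g"
    using reduction_terminates[of "- lead_set V" ?R v \<epsilon>, OF step \<open>v \<in> hat\<close> \<open>0 < \<epsilon>\<close>] by blast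
  then show ?thesis using trans by (intro bexI[of _ w]) auto
qed

text \<open>
  Truncated divisions at the levels \<open>1/(n+1)\<close> are chained. What is left to reduce after the step of
  index \<open>n\<close> lies below its level, so later steps no longer change the coefficients above it: the
  sequence converges, and its limit is congruent to \<open>v\<close> since \<open>V\<close> is closed. The last conjunct says
  that passing from \<open>v\<close> to its remainder changes no coefficient above all reducible elements of \<open>v\<close>; it gives the
  order condition and the continuity of the operator built from remainders.
\<close>

lemma remainder_exists:
  fixes V :: "('g \<Rightarrow> 'k::field) set"
  assumes V: "closed_subspace V" and v: "v \<in> hat"
  shows "\<exists>w\<in>hat. v - w \<in> V \<and> (\<forall>g\<in>supp w. g \<notin> lead_set V) \<and>
      (\<forall>g. (\<forall>h\<in>supp v. h \<in> lead_set V \<longrightarrow> h < g) \<longrightarrow> w g = v g)"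
proof -
  let ?above = "\<lambda>g. \<forall>h\<in>supp v. h \<in> lead_set V \<longrightarrow> h < g"
  let ?\<epsilon> = "\<lambda>n. 1 / real (Suc n)"
  let ?P = "\<lambda>n w. w \<in> hat \<and> v - w \<in> V \<and> (\<forall>g\<in>supp w. ?\<epsilon> n \<le> d g \<longrightarrow> g \<notin> lead_set V) \<and>
      (\<forall>g. ?above g \<longrightarrow> w g = v g)"
  have "\<exists>w. ?P 0 w"
    using remainder_above_level[OF V v, of "?\<epsilon> 0"] by fastforce
  moreover have "\<exists>y. ?P (Suc n) y \<and> agree (?\<epsilon> n) x y" if x: "?P n x" for n x
  proof -
    obtain y where y: "y \<in> hat" "x - y \<in> V"
        "\<forall>g\<in>supp y. ?\<epsilon> (Suc n) \<le> d g \<longrightarrow> g \<notin> lead_set V"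
        "\<And>g. (\<forall>h\<in>supp x. ?\<epsilon> (Suc n) \<le> d h \<longrightarrow> h \<in> lead_set V \<longrightarrow> h < g) \<Longrightarrow> y g = x g"
      using remainder_above_level[OF V, of x "?\<epsilon> (Suc n)"] x by auto
    have "v - y = (v - x) + (x - y)" by (rule ext) simp
    then have "v - y \<in> V" using subspace_add[OF V _ y(2)] x by (simp only:)
    moreover have "y g = v g" if g: "?above g" for g
    proof -
      have "h < g" if h: "h \<in> supp x" "h \<in> lead_set V" for h
      proof (rule ccontr)
        assume "\<not> h < g"
        then have "?above h" using g by (meson less_le_trans not_le)
        then have "x h = v h" using x by blast
        then have "h \<in> supp v" using h by (simp add: supp_def)
        then show False using \<open>\<not> h < g\<close> g h by blast
      qed
      then have "y g = x g" by (intro y(4)) blast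
      then show ?thesis using x g by simp
    qed
    moreover have "agree (?\<epsilon> n) x y"
      unfolding agree_def
    proof (intro ballI impI)
      fix g assume g: "g \<in> G" "?\<epsilon> n \<le> d g"
      have "h < g" if h: "h \<in> supp x" "h \<in> lead_set V" for h
      proof (rule ccontr)
        assume "\<not> h < g"
        moreover have "h \<in> G" using h x by (auto simp: hatKG_def)
        ultimately have "d g \<le> d h" using g d_mono by (simp add: not_less)
        then show False using x h g by fastforce
      qed
      then show "x g = y g" using y(4)[of g] by simp
    qed
    ultimately show ?thesis using y(1,3) by blast
  qed
  ultimately obtain s where s: "\<And>n. ?P n (s n)" "\<And>n. agree (?\<epsilon> n) (s n) (s (Suc n))"
    using dependent_nat_choice[of ?P "\<lambda>n. agree (?\<epsilon> n)"] by blast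
  have stable: "s n g = s m g" if "g \<in> G" "?\<epsilon> m \<le> d g" "m \<le> n" for n m g
    using \<open>m \<le> n\<close>
  proof (induction n rule: dec_induct)
    case (step n)
    have "?\<epsilon> n \<le> ?\<epsilon> m" using step by (intro divide_left_mono) auto
    then have "?\<epsilon> n \<le> d g" using that(2) by linarith
    then show ?case using s(2)[of n] step that(1) by (simp add: agree_def)
  qed simp
  have "\<exists>n. ?\<epsilon> n \<le> d g" if "g \<in> G" for g
    using nat_approx_posE[of "d g"] d_pos that by (metis less_imp_le)
  then obtain N where N: "\<And>g. g \<in> G \<Longrightarrow> ?\<epsilon> (N g) \<le> d g" by metis
  \<comment> \<open>The limit: at \<open>N g\<close> the coefficient of \<open>g\<close> has become stationary.\<close>
  define w where "w g = (if g \<in> G then s (N g) g else 0)" for g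
  have w: "w g = s n g" if "g \<in> G" "?\<epsilon> n \<le> d g" for n g
    using stable[OF that(1) N[OF that(1)], of "max n (N g)"] stable[OF that, of "max n (N g)"] that
    by (simp add: w_def)
  have supp_w: "supp w \<subseteq> G" by (auto simp: supp_def w_def)
  have w_hat: "w \<in> hat"
    unfolding hatKG_def mem_Collect_eq
  proof (intro conjI allI impI supp_w)
    fix e :: real assume "0 < e"
    then obtain n where n: "?\<epsilon> n < e" using nat_approx_posE by blast
    then have "{g \<in> supp w. e \<le> d g} \<subseteq> {g \<in> supp (s n). e \<le> d g}"
      using w[of _ n] supp_w by (fastforce simp: supp_def)
    moreover have "finite {g \<in> supp (s n). e \<le> d g}" using s(1)[of n] \<open>0 < e\<close> by (simp add: hatKG_def)
    ultimately show "finite {g \<in> supp w. e \<le> d g}" by (rule finite_subset)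
  qed
  have "v - w \<in> V"
  proof (rule subspace_closed[OF V hatKG_diff[OF v w_hat]])
    fix r :: real assume "0 < r"
    then obtain n where n: "?\<epsilon> n < r" using nat_approx_posE by blast
    have "agree r (v - w) (v - s n)"
      unfolding agree_def using n w[of _ n] by auto
    then show "\<exists>u\<in>V. agree r (v - w) u" using s(1)[of n] by blast
  qed
  moreover have "g \<notin> lead_set V" if g: "g \<in> supp w" for g
  proof -
    have "g \<in> G" using g supp_w by blast
    then have "g \<in> supp (s (N g))" using g by (simp add: supp_def w_def)
    then show ?thesis using s(1)[of "N g"] N[OF \<open>g \<in> G\<close>] by blast
  qed
  moreover have "w g = v g" if "?above g" for g
    using s(1)[of "N g"] that hat_outside[OF v] by (simp add: w_def)
  ultimately show ?thesis using w_hat by blast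
qed

text \<open>The leading element of a non-zero difference would be in the support of one of the two remainders.\<close>

lemma remainder_unique:
  assumes V: "closed_subspace V" and "w \<in> hat" "w' \<in> hat" "w - w' \<in> V"
    and "\<forall>g\<in>supp w. g \<notin> lead_set V" "\<forall>g\<in>supp w'. g \<notin> lead_set V"
  shows "w = w'"
proof (rule ccontr)
  assume "w \<noteq> w'"
  then have "w - w' \<noteq> 0" by (metis eq_iff_diff_eq_0)
  then obtain g where g: "leads (w - w') g" using leads_exists[OF subspace_hat[OF V assms(4)]] by blast
  then have "g \<in> lead_set V" using assms(4) by (auto simp: lead_set_def)
  moreover have "g \<in> supp w \<or> g \<in> supp w'" using g by (auto simp: leads_def supp_def)
  ultimately show False using assms(5,6) by blast
qed

text \<open>
  The operator sends \<open>v\<close> to its remainder modulo \<open>V\<close>. Uniqueness of remainders makes it linear and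
  idempotent with kernel \<open>V\<close>. It does not increase \<open>\<delta>\<close>, because remainders do not grow upwards. A basis
  element is moved only if it is a leading element of \<open>V\<close>, and then its remainder is supported
  strictly below it.
\<close>

lemma RO_with_kernel:
  fixes V :: "('g \<Rightarrow> 'k::field) set"
  assumes V: "closed_subspace V"
  shows "\<exists>T\<in>RO G d. ker G d T = V"
proof -
  let ?is_rem = "\<lambda>v w. w \<in> hat \<and> v - w \<in> V \<and> (\<forall>g\<in>supp w. g \<notin> lead_set V) \<and>
      (\<forall>g. (\<forall>h\<in>supp v. h \<in> lead_set V \<longrightarrow> h < g) \<longrightarrow> w g = v g)"
  define T where "T v = (if v \<in> hat then SOME w. ?is_rem v w else undefined)" for v
  have T: "?is_rem v (T v)" if "v \<in> hat" for v
  proof -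
    have "\<exists>w. ?is_rem v w" using remainder_exists[OF V that] by blast
    then have *: "?is_rem v (SOME w. ?is_rem v w)" by (rule someI_ex)
    have "T v = (SOME w. ?is_rem v w)" unfolding T_def using that by (rule if_P)
    then show ?thesis by (rule ssubst) (rule *)
  qed
  have T_hat: "T v \<in> hat" if "v \<in> hat" for v using T[OF that] by (rule conjunct1)
  have T_diff: "v - T v \<in> V" if "v \<in> hat" for v
    using T[OF that, THEN conjunct2] by (rule conjunct1)
  have T_supp: "g \<notin> lead_set V" if "v \<in> hat" "g \<in> supp (T v)" for v g
    using T[OF that(1), THEN conjunct2, THEN conjunct2, THEN conjunct1] that(2) by (rule bspec)
  have T_above: "T v g = v g" if "v \<in> hat" "\<And>h. h \<in> supp v \<Longrightarrow> h \<in> lead_set V \<Longrightarrow> h < g" for v g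
    using T[OF that(1), THEN conjunct2, THEN conjunct2, THEN conjunct2] that(2) by blast
  have T_eqI: "T v = w"
    if "v \<in> hat" "w \<in> hat" "v - w \<in> V" "\<forall>g\<in>supp w. g \<notin> lead_set V" for v w
  proof (rule remainder_unique[OF V])
    have "T v - w = (v - w) - (v - T v)" by (rule ext) simp
    then show "T v - w \<in> V" using subspace_diff[OF V that(3) T_diff[OF that(1)]] by (simp only:)
  qed (use T_hat T_supp that in blast)+
  have T_add: "T (u + v) = T u + T v" if u: "u \<in> hat" and v: "v \<in> hat" for u v
  proof (rule T_eqI)
    show "u + v \<in> hat" "T u + T v \<in> hat" by (intro hatKG_add T_hat u v)+
    have "(u + v) - (T u + T v) = (u - T u) + (v - T v)" by (rule ext) simp
    then show "(u + v) - (T u + T v) \<in> V" using subspace_add[OF V T_diff[OF u] T_diff[OF v]] by (simp only:)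
    show "\<forall>g\<in>supp (T u + T v). g \<notin> lead_set V"
    proof
      fix g assume "g \<in> supp (T u + T v)"
      then have "g \<in> supp (T u) \<or> g \<in> supp (T v)" by (auto simp: supp_def)
      then show "g \<notin> lead_set V" using T_supp u v by blast
    qed
  qed
  have T_scal: "T (scal c v) = scal c (T v)" if v: "v \<in> hat" for c v
  proof (rule T_eqI)
    show "scal c v \<in> hat" "scal c (T v) \<in> hat" by (intro hatKG_scal T_hat v)+
    have "scal c v - scal c (T v) = scal c (v - T v)" by (rule ext) (simp add: scal_def algebra_simps)
    then show "scal c v - scal c (T v) \<in> V" using subspace_scal[OF V T_diff[OF v]] by (simp only:)
    show "\<forall>g\<in>supp (scal c (T v)). g \<notin> lead_set V"
      using T_supp[OF v] by (auto simp: supp_def scal_def)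
  qed
  have T_idem: "T (T v) = T v" if v: "v \<in> hat" for v
  proof (rule T_eqI)
    have "T v - T v = 0" by (rule ext) simp
    then show "T v - T v \<in> V" using subspace_zero[OF V] by (simp only:)
  qed (use T_hat T_supp v in blast)+
  have T_cont: "agree r (T u) (T v)" if u: "u \<in> hat" and v: "v \<in> hat" and r: "agree r u v" for u v r
    unfolding agree_def
  proof (intro ballI impI)
    fix g assume g: "g \<in> G" "r \<le> d g"
    let ?w = "u - v"
    have w: "?w \<in> hat" using hatKG_diff u v by blast
    have zero: "?w h = 0" if "g \<le> h" for h
    proof (cases "h \<in> G")
      case True
      then show ?thesis using d_mono[OF g(1) True that] g r by (simp add: agree_def)
    next
      case False
      then show ?thesis using hat_outside[OF w] by blast
    qed
    then have "h < g" if "h \<in> supp ?w" for h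
      using that unfolding supp_def mem_Collect_eq by (meson not_less)
    then have "T ?w g = ?w g" by (rule T_above[OF w])
    moreover have "u = ?w + v" by (rule ext) simp
    then have "T u = T ?w + T v" using T_add[OF w v] by (simp only:)
    ultimately show "T u g = T v g" using zero[of g] by simp
  qed
  have T_basis: "g' < g"
    if g: "g \<in> G" "T (basis_vec g) \<noteq> basis_vec g" "g' \<in> supp (T (basis_vec g))" for g g'
  proof -
    have b: "basis_vec g \<in> hat" by (rule basis_vec_hat[OF g(1)])
    have supp_b: "supp (basis_vec g :: 'g \<Rightarrow> 'k) = {g}" by (auto simp: supp_def basis_vec_def)
    have "g \<in> lead_set V"
    proof (rule ccontr)
      assume "g \<notin> lead_set V"
      moreover have "basis_vec g - basis_vec g = (0 :: 'g \<Rightarrow> 'k)" by (rule ext) simp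
      ultimately have "T (basis_vec g) = basis_vec g"
        using subspace_zero[OF V] by (intro T_eqI b) (simp_all only: supp_b, blast)
      then show False using g by blast
    qed
    then have "g' \<noteq> g" using T_supp[OF b] g(3) by blast
    moreover have "\<not> g < g'"
    proof
      assume "g < g'"
      then have "T (basis_vec g) g' = (basis_vec g :: 'g \<Rightarrow> 'k) g'" using T_above[OF b, of g'] by (simp add: supp_b)
      then show False using \<open>g < g'\<close> g(3) by (auto simp: supp_def basis_vec_def split: if_splits)
    qed
    ultimately show ?thesis by auto
  qed
  have "continuous_map (hat_topology G d) (hat_topology G d) T"
    unfolding continuous_map_agree using T_hat T_cont by blast
  moreover have "T \<in> hat \<rightarrow>\<^sub>E hat" by (rule PiE_I[OF T_hat]) (simp_all add: T_def)
  ultimately have "T \<in> RO G d"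
    unfolding RO_def mem_Collect_eq by (intro conjI ballI allI impI T_add T_scal T_idem T_basis)
  moreover have "ker G d T = V"
  proof (intro set_eqI iffI)
    fix v assume "v \<in> ker G d T"
    then have v: "v \<in> hat" "T v = 0" by (auto simp: ker_def)
    moreover have "v - 0 = v" by (rule ext) simp
    ultimately show "v \<in> V" using T_diff[OF v(1)] by (simp only:)
  next
    fix v assume v: "v \<in> V"
    have "v - 0 = v" by (rule ext) simp
    then have "T v = 0" using v subspace_hat[OF V v]
      by (intro T_eqI) (simp_all only: zero_hat, simp_all add: supp_def)
    then show "v \<in> ker G d T" using subspace_hat[OF V v] by (simp add: ker_def)
  qed
  ultimately show ?thesis by blast
qed

section \<open>The infimum of a family of operators\<close>

lemma closure_closed_subspace:
  fixes S :: "('g \<Rightarrow> 'k::field) set"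
  assumes S: "S \<subseteq> hat" "0 \<in> S"
    and add: "\<And>u v. u \<in> S \<Longrightarrow> v \<in> S \<Longrightarrow> u + v \<in> S"
    and scal: "\<And>c v. v \<in> S \<Longrightarrow> scal c v \<in> S"
  shows "closed_subspace (hat_topology G d closure_of S)"
proof -
  let ?C = "hat_topology G d closure_of S"
  note iff = in_closure_iff[OF S(1)]
  have "?C \<subseteq> hat" using iff by blast
  moreover have "0 \<in> ?C" unfolding iff using S(2) agree_refl zero_hat by blast
  moreover have "u + v \<in> ?C" if u: "u \<in> ?C" and v: "v \<in> ?C" for u v
    unfolding iff
  proof (intro conjI allI impI)
    show "u + v \<in> hat" using u v hatKG_add unfolding iff by blast
    fix r :: real assume "0 < r"
    then obtain u' v' where "u' \<in> S" "agree r u u'" "v' \<in> S" "agree r v v'"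
      using u v unfolding iff by meson
    then show "\<exists>w\<in>S. agree r (u + v) w"
      by (intro bexI[of _ "u' + v'"] add) (simp_all add: agree_def)
  qed
  moreover have "scal c v \<in> ?C" if v: "v \<in> ?C" for c v
    unfolding iff
  proof (intro conjI allI impI)
    show "scal c v \<in> hat" using v hatKG_scal unfolding iff by blast
    fix r :: real assume "0 < r"
    then obtain v' where "v' \<in> S" "agree r v v'" using v unfolding iff by meson
    then show "\<exists>w\<in>S. agree r (scal c v) w"
      by (intro bexI[of _ "scal c v'"] scal) (simp_all add: agree_def scal_def)
  qed
  moreover have "v \<in> ?C" if v: "v \<in> hat" "\<forall>r>0. \<exists>u\<in>?C. agree r v u" for v
    unfolding iff
  proof (intro conjI allI impI v(1))
    fix r :: real assume "0 < r"
    then obtain u where "u \<in> ?C" "agree r v u" using v(2) by blast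
    moreover obtain w where "w \<in> S" "agree r u w" using \<open>u \<in> ?C\<close> \<open>0 < r\<close> unfolding iff by meson
    ultimately show "\<exists>w\<in>S. agree r v w" by (intro bexI[of _ w]) (simp_all add: agree_def)
  qed
  ultimately show ?thesis unfolding closed_subspace_def by (intro conjI ballI allI impI)
qed

context
  fixes F :: "(('g \<Rightarrow> 'k::field) \<Rightarrow> ('g \<Rightarrow> 'k)) set"
  assumes F: "F \<subseteq> RO G d"
begin

abbreviation rew :: "('g \<Rightarrow> 'k) \<Rightarrow> ('g \<Rightarrow> 'k) \<Rightarrow> bool" where
  "rew \<equiv> rewrites_into G d F"

lemma sum_ker_zero: "0 \<in> sum_ker G d F"
  unfolding sum_ker_def mem_Collect_eq
  by (intro exI[of _ "{}"] exI[of _ "\<lambda>_. 0"]) simp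

text \<open>
  The finite sums contain at most one vector from each kernel. The new vector \<open>v\<close> is therefore merged with the
  summand that comes from the kernel of \<open>T\<close>, if there is one.
\<close>

lemma sum_ker_add_ker:
  assumes "T \<in> F" "v \<in> ker G d T" "u \<in> sum_ker G d F"
  shows "v + u \<in> sum_ker G d F"
proof -
  obtain A w where A: "u = (\<Sum>T\<in>A. w T)" "finite A" "A \<subseteq> F" "\<forall>T\<in>A. w T \<in> ker G d T"
    using assms(3) unfolding sum_ker_def by blast
  define x where "x = (if T \<in> A then w T else 0)"
  have T: "T \<in> RO G d" using F assms(1) by blast
  have "0 \<in> ker G d T" unfolding ker_def using RO_zero[OF T] zero_hat by blast
  then have x: "x \<in> ker G d T" using A(4) by (simp add: x_def)
  have "v + x \<in> hat" "T (v + x) = T v + T x"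
    using assms(2) x hatKG_add RO_add[OF T] unfolding ker_def by blast+
  then have vx: "v + x \<in> ker G d T"
    using assms(2) x unfolding ker_def mem_Collect_eq by (metis add_0)
  have "u = x + (\<Sum>S\<in>A - {T}. w S)"
    using A(1) sum.remove[OF A(2), of T w] by (simp add: x_def)
  moreover have "(\<Sum>S\<in>insert T A. (w(T := v + x)) S) = (v + x) + (\<Sum>S\<in>A - {T}. w S)"
    using A(2) by (simp add: sum.insert_remove)
  ultimately have "v + u = (\<Sum>S\<in>insert T A. (w(T := v + x)) S)" by (metis add.assoc)
  moreover have "finite (insert T A)" "insert T A \<subseteq> F" using A assms(1) by simp_all
  moreover have "\<forall>S\<in>insert T A. (w(T := v + x)) S \<in> ker G d S" using A(4) vx by simp
  ultimately show ?thesis unfolding sum_ker_def mem_Collect_eq by blast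
qed

lemma sum_ker_induct [consumes 1, case_names zero add]:
  assumes "u \<in> sum_ker G d F" and zero: "P 0"
    and add: "\<And>T v u. T \<in> F \<Longrightarrow> v \<in> ker G d T \<Longrightarrow> u \<in> hat \<Longrightarrow> P u \<Longrightarrow> P (v + u)"
  shows "P u"
proof -
  have "(\<Sum>T\<in>A. w T) \<in> hat \<and> P (\<Sum>T\<in>A. w T)"
    if "finite A" "A \<subseteq> F" "\<forall>T\<in>A. w T \<in> ker G d T" for A w
    using that
  proof (induction A rule: finite_induct)
    case empty
    show ?case unfolding sum.empty using zero zero_hat by (rule conjI[rotated])
  next
    case (insert T A)
    then have IH: "(\<Sum>T\<in>A. w T) \<in> hat" "P (\<Sum>T\<in>A. w T)" and w: "w T \<in> ker G d T" "T \<in> F"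
      by simp_all
    have "w T \<in> hat" using w by (simp add: ker_def)
    then show ?case
      unfolding sum.insert[OF insert.hyps] using hatKG_add[OF _ IH(1)] add[OF w(2,1) IH] by blast
  qed
  then show ?thesis using assms(1) unfolding sum_ker_def by blast
qed

lemma sum_ker_hat: "sum_ker G d F \<subseteq> hat"
proof
  fix u :: "'g \<Rightarrow> 'k" assume "u \<in> sum_ker G d F"
  then show "u \<in> hat"
  proof (induction rule: sum_ker_induct)
    case (add T v u)
    then show ?case using hatKG_add unfolding ker_def by blast
  qed (rule zero_hat)
qed

lemma sum_ker_add:
  assumes "u \<in> sum_ker G d F" "v \<in> sum_ker G d F"
  shows "u + v \<in> sum_ker G d F"
  using assms(1)
proof (induction rule: sum_ker_induct)
  case zero
  show ?case unfolding add_0 by (rule assms(2))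
next
  case (add T w u)
  then show ?case unfolding add.assoc using sum_ker_add_ker by blast
qed

lemma sum_ker_scal:
  assumes "u \<in> sum_ker G d F"
  shows "scal c u \<in> sum_ker G d F"
  using assms
proof (induction rule: sum_ker_induct)
  case zero
  have "scal c 0 = (0 :: 'g \<Rightarrow> 'k)" by (rule ext) (simp add: scal_def)
  then show ?case using sum_ker_zero by (simp only:)
next
  case (add T w u)
  have "T \<in> RO G d" using F add by blast
  then have "T (scal c w) = scal c (T w)" "scal c (T w) = 0" "scal c w \<in> hat"
    using add RO_scal[of T w c] hatKG_scal[of w G d c] by (auto simp: ker_def scal_def)
  then have "scal c w \<in> ker G d T" by (simp add: ker_def)
  moreover have "scal c (w + u) = scal c w + scal c u"
    by (rule ext) (simp add: scal_def algebra_simps)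
  ultimately show ?case using sum_ker_add_ker[OF add(1) _ add(4)] by (simp only:)
qed

lemma ker_subset_sum_ker:
  assumes "T \<in> F"
  shows "ker G d T \<subseteq> sum_ker G d F"
proof
  fix v assume "v \<in> ker G d T"
  then have "v + 0 \<in> sum_ker G d F" using sum_ker_add_ker[OF assms _ sum_ker_zero] by blast
  then show "v \<in> sum_ker G d F" unfolding add_0_right .
qed

text \<open>Surjectivity of \<open>ker\<close> onto the closed subspaces is what makes the choice behind \<open>\<and>F\<close> meaningful.\<close>

lemma
  shows wedge_RO: "wedge G d F \<in> RO G d"
    and ker_wedge: "ker G d (wedge G d F) = hat_topology G d closure_of sum_ker G d F"
proof -
  have "closed_subspace (hat_topology G d closure_of sum_ker G d F)"
    by (intro closure_closed_subspace sum_ker_hat sum_ker_zero sum_ker_add sum_ker_scal)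
  from RO_with_kernel[OF this]
  have *: "hat_topology G d closure_of sum_ker G d F \<in> ker G d ` RO G d" by blast
  show "wedge G d F \<in> RO G d" unfolding wedge_def ker_inv_def by (rule inv_into_into[OF *])
  show "ker G d (wedge G d F) = hat_topology G d closure_of sum_ker G d F"
    unfolding wedge_def ker_inv_def by (rule f_inv_into_f[OF *])
qed

section \<open>Normal forms above a level\<close>

definition normal :: "real \<Rightarrow> ('g \<Rightarrow> 'k) \<Rightarrow> bool" where
  "normal \<epsilon> v \<longleftrightarrow> (\<forall>g\<in>supp v. \<epsilon> \<le> d g \<longrightarrow> g \<in> nf_set G F)"

lemma nf_set_nf: "g \<in> nf_set G F \<Longrightarrow> T \<in> F \<Longrightarrow> g \<in> nf G T"
  by (simp add: nf_set_def)

lemma rew_hat: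
  assumes "rew v w" "v \<in> hat"
  shows "w \<in> hat"
  using assms
proof (induction rule: rtranclp_induct)
  case (step x y)
  then obtain T where "T \<in> F" "y = T x" "x \<in> hat" by (auto simp: rew_step_def)
  then show ?case using RO_hat[of T x] F by blast
qed

lemma rew_stepI: "T \<in> F \<Longrightarrow> v \<in> hat \<Longrightarrow> rew_step G d F v (T v)"
  by (auto simp: rew_step_def)

lemma rewrites_to_normal:
  assumes "v \<in> hat" "0 < \<epsilon>"
  shows "\<exists>w\<in>hat. rew v w \<and> normal \<epsilon> w"
proof -
  have step: "\<exists>w\<in>hat. rew_step G d F v w \<and> w h = 0 \<and> (\<forall>k>h. w k = v k)"
    if v: "v \<in> hat" and h: "h \<in> supp v" "h \<notin> nf_set G F"
      and nf: "\<forall>k\<in>supp v. h < k \<longrightarrow> k \<in> nf_set G F" for v h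
  proof -
    have "h \<in> G" using v h by (auto simp: hatKG_def)
    then obtain T where T: "T \<in> F" "h \<notin> nf G T" using h(2) by (auto simp: nf_set_def)
    have RO: "T \<in> RO G d" using F T by blast
    have "\<forall>k>h. v k \<noteq> 0 \<longrightarrow> k \<in> nf G T" using nf nf_set_nf[OF _ T(1)] by (simp add: supp_def)
    note kill = RO_kill[OF RO v \<open>h \<in> G\<close> T(2) this]
    show ?thesis
      using kill RO_hat[OF RO v] rew_stepI[OF T(1) v] by (intro bexI[of _ "T v"] conjI allI impI)
  qed
  obtain w where "w \<in> hat" "rew v w" "\<forall>g\<in>supp w. \<epsilon> \<le> d g \<longrightarrow> g \<in> nf_set G F"
    using reduction_terminates[of "nf_set G F" "rew_step G d F" v \<epsilon>, OF step assms] by blast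
  then show ?thesis unfolding normal_def by blast
qed

text \<open>
  Above the level all basis elements are fixed by all operators of \<open>F\<close>, and by triangularity nothing
  can come up from below.
\<close>

lemma normal_stable:
  assumes "rew v w" and v: "v \<in> hat" "normal \<epsilon> v"
  shows "agree \<epsilon> v w"
  using assms(1)
proof (induction rule: rtranclp_induct)
  case base
  show ?case by (simp add: agree_def)
next
  case (step x y)
  then obtain T where T: "T \<in> F" "y = T x" "x \<in> hat" by (auto simp: rew_step_def)
  have RO: "T \<in> RO G d" using F T by blast
  have "T x g = x g" if g: "g \<in> G" "\<epsilon> \<le> d g" for g
  proof (rule RO_fix[OF RO T(3) g(1) _ order_refl], intro allI impI)
    fix h assume h: "g \<le> h" "x h \<noteq> 0"
    then have "h \<in> G" using hat_outside[OF T(3)] by blast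
    then have "\<epsilon> \<le> d h" using d_mono[OF g(1) _ h(1)] g(2) by linarith
    then have "v h \<noteq> 0" using step.IH h \<open>h \<in> G\<close> by (simp add: agree_def)
    then show "h \<in> nf G T"
      using v(2) \<open>\<epsilon> \<le> d h\<close> nf_set_nf[OF _ T(1)] by (simp add: normal_def supp_def)
  qed
  then show ?case using step.IH T(2) by (simp add: agree_def)
qed

lemma top_rewrites_iff:
  assumes "w \<in> hat"
  shows "top_rewrites G d F v w \<longleftrightarrow> (\<forall>r>0. \<exists>u\<in>hat. agree r w u \<and> rew v u)"
  unfolding top_rewrites_def by (rule open_neighbourhood_iff[OF assms])

section \<open>Confluence implies delta-confluence\<close>

text \<open>A step changes the vector by an element of \<open>ker T\<close>, which is contained in the kernel of \<open>\<and>F\<close>.\<close>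

lemma wedge_rew:
  assumes "rew v w" "v \<in> hat"
  shows "wedge G d F w = wedge G d F v"
  using assms
proof (induction rule: rtranclp_induct)
  case (step x y)
  then obtain T where T: "T \<in> F" "y = T x" "x \<in> hat" by (auto simp: rew_step_def)
  have RO: "T \<in> RO G d" using F T by blast
  have y: "y \<in> hat" using RO_hat[OF RO] T by blast
  have "T (x - y) = T x - T y" by (rule RO_diff[OF RO T(3) y])
  also have "\<dots> = 0" unfolding T(2) RO_idem[OF RO T(3)] by (rule diff_self)
  finally have "x - y \<in> ker G d T" using hatKG_diff[OF T(3) y] by (simp add: ker_def)
  then have "x - y \<in> sum_ker G d F" using ker_subset_sum_ker[OF T(1)] by blast
  then have "x - y \<in> ker G d (wedge G d F)"
    unfolding ker_wedge in_closure_iff[OF sum_ker_hat] using sum_ker_hat agree_refl by blast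
  then have "wedge G d F x - wedge G d F y = 0"
    unfolding ker_def RO_diff[OF wedge_RO T(3) y, symmetric] by blast
  then show ?case using step.IH step.prems by simp
qed simp

text \<open>
  For any level \<open>r\<close>, \<open>v\<close> rewrites into some \<open>u\<close> whose basis elements above \<open>r\<close> are in \<open>nf(F)\<close>. By
  confluence these are fixed by \<open>\<and>F\<close>, so \<open>u\<close> agrees above \<open>r\<close> with \<open>\<and>F(u) = \<and>F(v)\<close>.
\<close>

lemma top_rewrites_wedge:
  assumes "confluent G d F" and v: "v \<in> hat"
  shows "top_rewrites G d F v (wedge G d F v)"
proof -
  let ?W = "wedge G d F"
  note W = wedge_RO
  have "\<exists>u\<in>hat. agree r (?W v) u \<and> rew v u" if r: "0 < r" for r
  proof -
    obtain u where u: "u \<in> hat" "rew v u" "normal r u" using rewrites_to_normal[OF v r] by blast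
    have "?W u g = u g" if g: "g \<in> G" "r \<le> d g" for g
    proof (rule RO_fix[OF W u(1) g(1) _ order_refl], intro allI impI)
      fix h assume h: "g \<le> h" "u h \<noteq> 0"
      then have "h \<in> G" using hat_outside[OF u(1)] by blast
      then have "r \<le> d h" using d_mono[OF g(1) _ h(1)] g(2) by linarith
      then have "h \<in> nf_set G F" using u(3) h by (simp add: normal_def supp_def)
      then show "h \<in> nf G ?W" using assms(1) by (auto simp: confluent_def)
    qed
    then have "agree r (?W v) u" unfolding agree_def wedge_rew[OF u(2) v, symmetric] by blast
    then show ?thesis using u by blast
  qed
  then show ?thesis unfolding top_rewrites_iff[OF RO_hat[OF W v]] by blast
qed

lemma confluent_imp_delta_confluent:
  assumes "confluent G d F"
  shows "delta_confluent G d F"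
  unfolding delta_confluent_def
proof (intro ballI allI impI, elim conjE)
  fix a b c assume a: "a \<in> hat" and b: "rew a b" and c: "rew a c"
  have "top_rewrites G d F b (wedge G d F a)" "top_rewrites G d F c (wedge G d F a)"
    using top_rewrites_wedge[OF assms rew_hat[OF b a]] top_rewrites_wedge[OF assms rew_hat[OF c a]]
    unfolding wedge_rew[OF b a] wedge_rew[OF c a] .
  then show "\<exists>e\<in>hat. top_rewrites G d F b e \<and> top_rewrites G d F c e"
    using RO_hat[OF wedge_RO a] by blast
qed

section \<open>Delta-confluence implies confluence\<close>

text \<open>
  Two normal forms \<open>b\<close> and \<open>c\<close> above \<open>\<epsilon>\<close> rewrite into vectors arbitrarily close to a common \<open>e\<close>, while
  rewriting does not change what they are above \<open>\<epsilon>\<close>.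
\<close>

lemma normal_unique:
  assumes dc: "delta_confluent G d F" and a: "a \<in> hat" and "0 < \<epsilon>"
    and b: "rew a b" "normal \<epsilon> b" and c: "rew a c" "normal \<epsilon> c"
  shows "agree \<epsilon> b c"
proof -
  obtain e where e: "e \<in> hat" "top_rewrites G d F b e" "top_rewrites G d F c e"
    using dc a b(1) c(1) unfolding delta_confluent_def by meson
  obtain b' where b': "agree \<epsilon> e b'" "rew b b'"
    using e(2) \<open>0 < \<epsilon>\<close> unfolding top_rewrites_iff[OF e(1)] by meson
  obtain c' where c': "agree \<epsilon> e c'" "rew c c'"
    using e(3) \<open>0 < \<epsilon>\<close> unfolding top_rewrites_iff[OF e(1)] by meson
  have "agree \<epsilon> b b'" "agree \<epsilon> c c'"
    using normal_stable[OF b'(2) rew_hat[OF b(1) a] b(2)]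
      normal_stable[OF c'(2) rew_hat[OF c(1) a] c(2)] .
  then show ?thesis using b'(1) c'(1) by (simp add: agree_def)
qed

text \<open>
  A step cannot be applied to one summand only, as an operator acts on the whole sum. Applying the
  same operators to the other summand as well keeps the sum in the relation; it is additivity of normal
  forms that later makes the resulting change of \<open>v\<close> harmless.
\<close>

lemma rew_parallel:
  assumes "rew u u'" and u: "u \<in> hat" and v: "v \<in> hat"
  shows "\<exists>v'. rew v v' \<and> rew (u + v) (u' + v')"
  using assms(1)
proof (induction rule: rtranclp_induct)
  case base
  show ?case by blast
next
  case (step x y)
  then obtain v' where v': "rew v v'" "rew (u + v) (x + v')" by blast
  obtain T where T: "T \<in> F" "y = T x" "x \<in> hat" using step.hyps(2) by (auto simp: rew_step_def)
  have RO: "T \<in> RO G d" using F T by blast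
  have v'_hat: "v' \<in> hat" by (rule rew_hat[OF v'(1) v])
  have "rew_step G d F (x + v') (T (x + v'))"
    by (rule rew_stepI[OF T(1) hatKG_add[OF T(3) v'_hat]])
  then have "rew_step G d F (x + v') (y + T v')"
    unfolding RO_add[OF RO T(3) v'_hat] T(2) .
  then have "rew (u + v) (y + T v')" by (rule rtranclp.rtrancl_into_rtrancl[OF v'(2)])
  moreover have "rew v (T v')"
    using rew_stepI[OF T(1) v'_hat] by (rule rtranclp.rtrancl_into_rtrancl[OF v'(1)])
  ultimately show ?case by blast
qed

text \<open>
  By induction on the number of summands. The sum \<open>u\<close> is first rewritten to a negligible \<open>s\<close>, which turns the
  new summand \<open>v\<close> into some \<open>v1\<close>; then \<open>v1\<close> is rewritten to a normal form, which leaves \<open>s\<close> negligible.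
  As \<open>v\<close> is in a kernel it also rewrites into 0 in one step, so by uniqueness of normal forms the one of
  \<open>v1\<close> is negligible as well.
\<close>

lemma sum_ker_rewrites_near_zero:
  assumes dc: "delta_confluent G d F" and "u \<in> sum_ker G d F" and "0 < \<epsilon>"
  shows "\<exists>s. rew u s \<and> agree \<epsilon> 0 s"
  using assms(2)
proof (induction rule: sum_ker_induct)
  case zero
  show ?case by (intro exI[of _ 0] conjI rtranclp.rtrancl_refl) (simp add: agree_def)
next
  case (add T v u)
  have v: "v \<in> hat" "T v = 0" using add(2) by (auto simp: ker_def)
  obtain s where s: "rew u s" "agree \<epsilon> 0 s" using add(4) by blast
  have s_hat: "s \<in> hat" by (rule rew_hat[OF s(1) add(3)])
  \<comment> \<open>Vacuously: nothing of \<open>s\<close> is above the level.\<close>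
  have s_normal: "normal \<epsilon> s"
    unfolding normal_def
  proof (intro ballI impI)
    fix g assume "g \<in> supp s" "\<epsilon> \<le> d g"
    moreover from this have "g \<in> G" using s_hat by (auto simp: hatKG_def)
    ultimately show "g \<in> nf_set G F" using s(2) by (simp add: agree_def supp_def)
  qed
  obtain v1 where v1: "rew v v1" "rew (u + v) (s + v1)"
    using rew_parallel[OF s(1) add(3) v(1)] by blast
  have v1_hat: "v1 \<in> hat" by (rule rew_hat[OF v1(1) v(1)])
  obtain v2 where v2: "rew v1 v2" "normal \<epsilon> v2"
    using rewrites_to_normal[OF v1_hat \<open>0 < \<epsilon>\<close>] by blast
  have "rew v 0"
    using rew_stepI[OF add(1) v(1)] unfolding v(2) by (rule r_into_rtranclp[of "rew_step G d F"])
  moreover have "normal \<epsilon> 0" by (simp add: normal_def supp_def)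
  ultimately have "agree \<epsilon> 0 v2"
    using normal_unique[OF dc v(1) \<open>0 < \<epsilon>\<close> _ _ rtranclp_trans[OF v1(1) v2(1)] v2(2)] by blast
  moreover obtain s1 where s1: "rew s s1" "rew (v1 + s) (v2 + s1)"
    using rew_parallel[OF v2(1) v1_hat s_hat] by blast
  moreover have "agree \<epsilon> s s1" by (rule normal_stable[OF s1(1) s_hat s_normal])
  ultimately have "agree \<epsilon> 0 (v2 + s1)" using s(2) by (simp add: agree_def)
  moreover have "rew (v + u) (v1 + s)" using v1(2) by (simp only: add.commute)
  then have "rew (v + u) (v2 + s1)" by (rule rtranclp_trans[OF _ s1(2)])
  ultimately show ?case by blast
qed

lemma rew_keeps_leading:
  assumes "rew u s" and u: "u \<in> hat" and g: "g \<in> nf_set G F" and above: "\<forall>h>g. u h = 0"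
  shows "\<forall>h\<ge>g. s h = u h"
  using assms(1)
proof (induction rule: rtranclp_induct)
  case (step x y)
  then obtain T where T: "T \<in> F" "y = T x" "x \<in> hat" by (auto simp: rew_step_def)
  have RO: "T \<in> RO G d" using F T by blast
  have "\<forall>h\<ge>g. x h \<noteq> 0 \<longrightarrow> h \<in> nf G T"
  proof (intro allI impI)
    fix h assume h: "g \<le> h" "x h \<noteq> 0"
    then have "u h \<noteq> 0" using step.IH by simp
    then have "h = g" using above h(1) by (metis order_le_less)
    then show "h \<in> nf G T" using nf_set_nf[OF g T(1)] by simp
  qed
  moreover have "g \<in> G" using g by (simp add: nf_set_def)
  ultimately have "T x h = x h" if "g \<le> h" for h using RO_fix[OF RO T(3)] that by blast
  then show ?case using step.IH T(2) by simp
qed simp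

text \<open>
  If \<open>g\<close> is a common normal form moved by \<open>\<and>F\<close>, then \<open>v = g - \<and>F(g)\<close> has leading element \<open>g\<close> and is a limit of
  finite sums from the kernels. An approximation \<open>u\<close> at level \<open>d g\<close> has the same leading term, which
  rewriting preserves, although \<open>u\<close> can be rewritten to a vector that vanishes above the level \<open>d g\<close>.
\<close>

lemma delta_confluent_imp_confluent:
  assumes dc: "delta_confluent G d F"
  shows "confluent G d F"
proof -
  let ?W = "wedge G d F"
  have False if g: "g \<in> nf_set G F" "g \<notin> nf G ?W" for g
  proof -
    have gG: "g \<in> G" using g by (simp add: nf_set_def)
    have b: "(basis_vec g :: 'g \<Rightarrow> 'k) \<in> hat" by (rule basis_vec_hat[OF gG])
    have Wb: "?W (basis_vec g) \<in> hat" by (rule RO_hat[OF wedge_RO b])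
    define v where "v = basis_vec g - ?W (basis_vec g)"
    have "?W v = ?W (basis_vec g) - ?W (?W (basis_vec g))"
      unfolding v_def by (rule RO_diff[OF wedge_RO b Wb])
    also have "\<dots> = 0" unfolding RO_idem[OF wedge_RO b] by (rule diff_self)
    finally have "v \<in> ker G d ?W" using hatKG_diff[OF b Wb] by (simp add: ker_def v_def)
    moreover have "0 < d g" using d_pos gG by blast
    ultimately obtain u where u: "u \<in> sum_ker G d F" "agree (d g) v u" and v_hat: "v \<in> hat"
      unfolding ker_wedge in_closure_iff[OF sum_ker_hat] by meson
    have u_hat: "u \<in> hat" using u(1) sum_ker_hat by blast
    have "?W (basis_vec g) \<noteq> basis_vec g" using g(2) gG by (simp add: nf_def)
    then have W0: "?W (basis_vec g) h = 0" if "g \<le> h" for h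
      using RO_basis[OF wedge_RO gG, of h] that by force
    have v_lead: "v h = (if h = g then 1 else 0)" if "g \<le> h" for h
      using W0[OF that] by (simp add: v_def basis_vec_def)
    have u_lead: "u h = (if h = g then 1 else 0)" if "g \<le> h" for h
    proof (cases "h \<in> G")
      case True
      then have "u h = v h" using u(2) d_mono[OF gG True that] by (simp add: agree_def)
      then show ?thesis using v_lead[OF that] by simp
    next
      case False
      then show ?thesis using hat_outside[OF u_hat] gG by auto
    qed
    obtain s where s: "rew u s" "agree (d g) 0 s"
      using sum_ker_rewrites_near_zero[OF dc u(1) \<open>0 < d g\<close>] by blast
    have "\<forall>h>g. u h = 0" using u_lead by auto
    from rew_keeps_leading[OF s(1) u_hat g(1) this] have "s g = u g" by simp
    moreover have "s g = 0" using s(2) gG by (simp add: agree_def)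
    ultimately show False using u_lead[of g] by simp
  qed
  then show ?thesis unfolding confluent_def by blast
qed

end

end

theorem theorem3p1p7:
  fixes G :: "'g::linorder set" and d :: "'g \<Rightarrow> real"
    and F :: "(('g \<Rightarrow> 'k::field) \<Rightarrow> ('g \<Rightarrow> 'k)) set"
  assumes "\<forall>g\<in>G. 0 < d g"
    and "elimination_map G d"
    and "F \<subseteq> RO G d"
  shows "confluent G d F \<longleftrightarrow> delta_confluent G d F"
proof -
  interpret elimination G d by (rule elimination.intro[OF assms(1,2)])
  show ?thesis
    using confluent_imp_delta_confluent[OF assms(3)] delta_confluent_imp_confluent[OF assms(3)]
    by (rule iffI)
qed

end
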